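(* Let $f:X\to X$ be a pointwise periodic homeomorphism of a compact metric space $X$. The following are equivalent: (1) $(X,f)$ is not equicontinuous; (2) $(2^X,2^f)$ is not equicontinuous; (3) there exists an uncountable set $S\subset R(2^f)$ which is both a scrambled set and an $\omega$-scrambled set for $2^f$ (in particular, $(2^X,2^f)$ is both Li-Yorke chaotic and $\omega$-chaotic); (4) $(2^X,2^f)$ has a Li-Yorke pair; (5) $(2^X,2^f)$ has an $\omega$-scrambled set of cardinality at least two; (6) $R(2^f)\setminus AP(2^f)\neq\emptyset$.
   Context: $f$ is pointwise periodic if for every $x\in X$ there is an integer $n\geq 1$ with $f^n(x)=x$. $2^X$ is the space of nonempty closed subsets of $X$ with the Hausdorff metric, and $2^f:2^X\to 2^X$, $2^f(A)=f(A)$. Let $g$ be a continuous self-map of a compact metric space $(Z,\rho)$. $(Z,g)$ is equicontinuous if the family $\{g^n:n\geq 0\}$ is equicontinuous. $\omega_g(z)=\bigcap_{n\in\mathbb{N}}\overline{\{g^k(z):k\geq n\}}$. The point $z$ is recurrent if $z\in\omega_g(z)$; $z$ is almost periodic if for every neighborhood $U$ of $z$ there exists $N\in\mathbb{N}$ such that $\{g^{n+i}(z): i=0,\dots,N\}\cap U\neq\emptyset$ for all integers $n\geq 0$. $R(g)$ and $AP(g)$ are the sets of recurrent and almost periodic points. A pair $(x,y)$ is proximal if $\liminf_{n\to\infty}\rho(g^n(x),g^n(y))=0$, asymptotic if $\limsup_{n\to\infty}\rho(g^n(x),g^n(y))=0$, and a Li-Yorke pair if it is proximal but not asymptotic. A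 scrambled set is a set $S\subset Z$ such that every pair of distinct points of $S$ is a Li-Yorke pair; $(Z,g)$ is Li-Yorke chaotic if it has an uncountable scrambled set. A subset $S\subset Z$ with at least two points is an $\omega$-scrambled set if for all $x,y\in S$ with $x\neq y$: (i) $\omega_g(x)\setminus\omega_g(y)$ is uncountable; (ii) $\omega_g(x)\cap\omega_g(y)\neq\emptyset$; (iii) $\omega_g(x)$ is not pointwise periodic, i.e. it contains a point that is not periodic for $g$. $(Z,g)$ is $\omega$-chaotic if it has an uncountable $\omega$-scrambled set. *)

theory Defs
  imports "HOL-Analysis.Analysis"
begin

text \<open>
  A metric space is given by a carrier and a distance function satisfying
  \<^locale>\<open>Metric_space\<close>, so that the same notions of dynamics apply to a space and to its
  hyperspace.  Only the values of a map on the carrier matter.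
\<close>

definition pointwise_periodic :: "'a set \<Rightarrow> ('a \<Rightarrow> 'a) \<Rightarrow> bool" where
  "pointwise_periodic Z g \<longleftrightarrow> (\<forall>z\<in>Z. \<exists>n\<ge>1. (g ^^ n) z = z)"

definition equicontinuous_system :: "'a set \<Rightarrow> ('a \<Rightarrow> 'a \<Rightarrow> real) \<Rightarrow> ('a \<Rightarrow> 'a) \<Rightarrow> bool" where
  "equicontinuous_system Z \<rho> g \<longleftrightarrow>
     (\<forall>x\<in>Z. \<forall>\<epsilon>>0. \<exists>\<delta>>0. \<forall>n. \<forall>y\<in>Z. \<rho> x y < \<delta> \<longrightarrow> \<rho> ((g ^^ n) x) ((g ^^ n) y) < \<epsilon>)"

definition omega_limit :: "'a set \<Rightarrow> ('a \<Rightarrow> 'a \<Rightarrow> real) \<Rightarrow> ('a \<Rightarrow> 'a) \<Rightarrow> 'a \<Rightarrow> 'a set" where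
  "omega_limit Z \<rho> g z =
     (\<Inter>n. Metric_space.mtopology Z \<rho> closure_of {(g ^^ k) z | k. k \<ge> n})"

definition recurrent_points :: "'a set \<Rightarrow> ('a \<Rightarrow> 'a \<Rightarrow> real) \<Rightarrow> ('a \<Rightarrow> 'a) \<Rightarrow> 'a set" where
  "recurrent_points Z \<rho> g = {z \<in> Z. z \<in> omega_limit Z \<rho> g z}"

definition almost_periodic_points :: "'a set \<Rightarrow> ('a \<Rightarrow> 'a \<Rightarrow> real) \<Rightarrow> ('a \<Rightarrow> 'a) \<Rightarrow> 'a set" where
  "almost_periodic_points Z \<rho> g =
     {z \<in> Z. \<forall>U. openin (Metric_space.mtopology Z \<rho>) U \<and> z \<in> U \<longrightarrow>
        (\<exists>N. \<forall>n. {(g ^^ (n + i)) z | i. i \<in> {0..N}} \<inter> U \<noteq> {})}"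

definition proximal :: "('a \<Rightarrow> 'a \<Rightarrow> real) \<Rightarrow> ('a \<Rightarrow> 'a) \<Rightarrow> 'a \<Rightarrow> 'a \<Rightarrow> bool" where
  "proximal \<rho> g x y \<longleftrightarrow> liminf (\<lambda>n. ereal (\<rho> ((g ^^ n) x) ((g ^^ n) y))) = 0"

definition asymptotic :: "('a \<Rightarrow> 'a \<Rightarrow> real) \<Rightarrow> ('a \<Rightarrow> 'a) \<Rightarrow> 'a \<Rightarrow> 'a \<Rightarrow> bool" where
  "asymptotic \<rho> g x y \<longleftrightarrow> limsup (\<lambda>n. ereal (\<rho> ((g ^^ n) x) ((g ^^ n) y))) = 0"

definition Li_Yorke_pair :: "('a \<Rightarrow> 'a \<Rightarrow> real) \<Rightarrow> ('a \<Rightarrow> 'a) \<Rightarrow> 'a \<Rightarrow> 'a \<Rightarrow> bool" where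
  "Li_Yorke_pair \<rho> g x y \<longleftrightarrow> proximal \<rho> g x y \<and> \<not> asymptotic \<rho> g x y"

definition scrambled_set ::
    "'a set \<Rightarrow> ('a \<Rightarrow> 'a \<Rightarrow> real) \<Rightarrow> ('a \<Rightarrow> 'a) \<Rightarrow> 'a set \<Rightarrow> bool" where
  "scrambled_set Z \<rho> g S \<longleftrightarrow>
     S \<subseteq> Z \<and> (\<forall>x\<in>S. \<forall>y\<in>S. x \<noteq> y \<longrightarrow> Li_Yorke_pair \<rho> g x y)"

definition Li_Yorke_chaotic :: "'a set \<Rightarrow> ('a \<Rightarrow> 'a \<Rightarrow> real) \<Rightarrow> ('a \<Rightarrow> 'a) \<Rightarrow> bool" where
  "Li_Yorke_chaotic Z \<rho> g \<longleftrightarrow> (\<exists>S. uncountable S \<and> scrambled_set Z \<rho> g S)"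

definition omega_scrambled_set ::
    "'a set \<Rightarrow> ('a \<Rightarrow> 'a \<Rightarrow> real) \<Rightarrow> ('a \<Rightarrow> 'a) \<Rightarrow> 'a set \<Rightarrow> bool" where
  "omega_scrambled_set Z \<rho> g S \<longleftrightarrow>
     S \<subseteq> Z \<and> (\<exists>x\<in>S. \<exists>y\<in>S. x \<noteq> y) \<and>
     (\<forall>x\<in>S. \<forall>y\<in>S. x \<noteq> y \<longrightarrow>
        uncountable (omega_limit Z \<rho> g x - omega_limit Z \<rho> g y) \<and>
        omega_limit Z \<rho> g x \<inter> omega_limit Z \<rho> g y \<noteq> {} \<and>
        \<not> pointwise_periodic (omega_limit Z \<rho> g x) g)"

definition omega_chaotic :: "'a set \<Rightarrow> ('a \<Rightarrow> 'a \<Rightarrow> real) \<Rightarrow> ('a \<Rightarrow> 'a) \<Rightarrow> bool" where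
  "omega_chaotic Z \<rho> g \<longleftrightarrow> (\<exists>S. uncountable S \<and> omega_scrambled_set Z \<rho> g S)"

definition hyperspace :: "'a set \<Rightarrow> ('a \<Rightarrow> 'a \<Rightarrow> real) \<Rightarrow> 'a set set" where
  "hyperspace X d = {A. closedin (Metric_space.mtopology X d) A \<and> A \<noteq> {}}"

text \<open>
  The suprema and infima are taken in the reals; they are the intended ones on the hyperspace
  of a bounded space, in particular of a compact one.  The value 0 off the hyperspace is needed
  only because \<^locale>\<open>Metric_space\<close> demands nonnegativity for all arguments, also those
  outside the carrier.
\<close>
definition hausdorff_dist ::
    "'a set \<Rightarrow> ('a \<Rightarrow> 'a \<Rightarrow> real) \<Rightarrow> 'a set \<Rightarrow> 'a set \<Rightarrow> real" where
  "hausdorff_dist X d A B =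
     (if A \<in> hyperspace X d \<and> B \<in> hyperspace X d
      then max (SUP a\<in>A. INF b\<in>B. d a b) (SUP b\<in>B. INF a\<in>A. d a b)
      else 0)"

definition all_equivalent :: "bool list \<Rightarrow> bool" where
  "all_equivalent Ps \<longleftrightarrow> (\<forall>P\<in>set Ps. \<forall>Q\<in>set Ps. P \<longleftrightarrow> Q)"

lemma Metric_space_hyperspace:
  assumes "Metric_space X d" and "compact_space (Metric_space.mtopology X d)"
  shows "Metric_space (hyperspace X d) (hausdorff_dist X d)"
proof -
  interpret Metric_space X d by fact
  have "mbounded X"
    using assms(2) compactin_imp_mbounded by (simp add: compact_space_def)
  then obtain K where K: "\<And>x y. x \<in> X \<Longrightarrow> y \<in> X \<Longrightarrow> d x y \<le> K"
    unfolding mbounded_alt by blast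
  define e where "e A B = (SUP a\<in>A. INF b\<in>B. d a b)" for A B
  have hd: "hausdorff_dist X d A B =
      (if A \<in> hyperspace X d \<and> B \<in> hyperspace X d then max (e A B) (e B A) else 0)" for A B
    unfolding hausdorff_dist_def e_def by (simp add: commute)
  have sub: "A \<subseteq> X" "A \<noteq> {}" if "A \<in> hyperspace X d" for A
    using that closedin_subset unfolding hyperspace_def by fastforce+
  have bb: "bdd_below (d a ` B)" for a B
    by (rule bdd_belowI2[of _ 0]) simp
  have Ile: "(INF b\<in>B. d a b) \<le> d a b" if "b \<in> B" for a b B
    using that bb by (rule cINF_lower[rotated])
  have I0: "0 \<le> (INF b\<in>B. d a b)" if "B \<noteq> {}" for a B
    using that by (rule cINF_greatest) simp
  have Ie: "(INF b\<in>B. d a b) \<le> e A B" if "a \<in> A" "A \<subseteq> X" "B \<subseteq> X" "B \<noteq> {}" for a A B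
  proof -
    obtain b where "b \<in> B" using \<open>B \<noteq> {}\<close> by blast
    have "bdd_above ((\<lambda>a. INF b\<in>B. d a b) ` A)"
    proof (rule bdd_aboveI2[of _ _ K])
      fix x assume "x \<in> A"
      then show "(INF b\<in>B. d x b) \<le> K"
        using Ile[OF \<open>b \<in> B\<close>, of x] K[of x b] that \<open>b \<in> B\<close> by fastforce
    qed
    then show ?thesis unfolding e_def by (rule cSUP_upper[OF \<open>a \<in> A\<close>])
  qed
  have e0: "0 \<le> e A B" if "A \<subseteq> X" "A \<noteq> {}" "B \<subseteq> X" "B \<noteq> {}" for A B
  proof -
    obtain a where "a \<in> A" using \<open>A \<noteq> {}\<close> by blast
    then show ?thesis using I0[of B a] Ie[of a A B] that by linarith
  qed
  have tri: "e A C \<le> e A B + e B C"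
    if "A \<subseteq> X" "A \<noteq> {}" "B \<subseteq> X" "B \<noteq> {}" "C \<subseteq> X" "C \<noteq> {}" for A B C
    unfolding e_def[of A C]
  proof (rule cSUP_least[OF \<open>A \<noteq> {}\<close>])
    fix a assume a: "a \<in> A"
    have "(INF c\<in>C. d a c) - e B C \<le> (INF b\<in>B. d a b)"
    proof (rule cINF_greatest[OF \<open>B \<noteq> {}\<close>])
      fix b assume b: "b \<in> B"
      have "(INF c\<in>C. d a c) - d a b \<le> (INF c\<in>C. d b c)"
      proof (rule cINF_greatest[OF \<open>C \<noteq> {}\<close>])
        fix c assume c: "c \<in> C"
        have "d a c \<le> d a b + d b c" using a b c that by (intro triangle) auto
        then show "(INF c\<in>C. d a c) - d a b \<le> d b c" using Ile[OF c, of a] by linarith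
      qed
      also have "\<dots> \<le> e B C" using b that by (intro Ie)
      finally show "(INF c\<in>C. d a c) - e B C \<le> d a b" by linarith
    qed
    also have "\<dots> \<le> e A B" using a that by (intro Ie)
    finally show "(INF c\<in>C. d a c) \<le> e A B + e B C" by linarith
  qed
  have ss: "A \<subseteq> B" if A: "A \<in> hyperspace X d" and B: "B \<in> hyperspace X d"
    and le: "e A B \<le> 0" for A B
  proof
    fix a assume a: "a \<in> A"
    have "a \<in> mtopology closure_of B"
      unfolding metric_closure_of
    proof (intro CollectI conjI allI impI)
      show "a \<in> X" using a sub(1)[OF A] by blast
      fix r :: real assume "r > 0"
      have "(INF b\<in>B. d a b) < r"
        using Ie[OF a sub(1)[OF A] sub[OF B]] le \<open>r > 0\<close> by linarith
      then obtain b where "b \<in> B" "d a b < r"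
        using cINF_less_iff[OF sub(2)[OF B] bb] by blast
      then show "\<exists>y\<in>B. y \<in> mball a r"
        using sub(1)[OF B] \<open>a \<in> X\<close> by (auto simp: in_mball)
    qed
    then show "a \<in> B" using B by (simp add: hyperspace_def closure_of_closedin)
  qed
  have refl: "e A A \<le> 0" if "A \<in> hyperspace X d" for A
    unfolding e_def
  proof (rule cSUP_least[OF sub(2)[OF that]])
    fix a assume "a \<in> A"
    then show "(INF b\<in>A. d a b) \<le> 0" using Ile[of a A a] sub(1)[OF that] by auto
  qed
  show ?thesis
  proof
    fix A B show "0 \<le> hausdorff_dist X d A B"
      using e0[OF sub sub, of A B] unfolding hd by auto
  next
    fix A B show "hausdorff_dist X d A B = hausdorff_dist X d B A"
      by (simp add: hd max.commute)
  next
    fix A B assume A: "A \<in> hyperspace X d" and B: "B \<in> hyperspace X d"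
    show "hausdorff_dist X d A B = 0 \<longleftrightarrow> A = B"
    proof
      assume "hausdorff_dist X d A B = 0"
      then show "A = B" using ss[OF A B] ss[OF B A] A B unfolding hd by (simp add: max_def split: if_splits)
    next
      assume "A = B"
      then show "hausdorff_dist X d A B = 0"
        using refl[OF A] e0[OF sub[OF A] sub[OF A]] A unfolding hd by simp
    qed
  next
    fix A B C
    assume h: "A \<in> hyperspace X d" "B \<in> hyperspace X d" "C \<in> hyperspace X d"
    note s = sub[OF h(1)] sub[OF h(2)] sub[OF h(3)]
    show "hausdorff_dist X d A C \<le> hausdorff_dist X d A B + hausdorff_dist X d B C"
      using tri[of A B C] tri[of C B A] s h unfolding hd by fastforce
  qed
qed

end

theory Submission
  imports Defs
begin

text \<open>
  Suppose $f$ is not equicontinuous at $x$, and let $C$ be the finite orbit of $x$. For every $L$,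
  the orbits under $f^L$ of points close to $C$ leave a neighbourhood of $C$ whose size does not
  depend on $L$: otherwise the orbit of every point reached from near $C$, being a cycle, would
  come close to $C$. Let $K$ be the set of points $z$ such that, for every $L$, some
  $f^{kL}(u)$ with $u$ close to $C$ is close to $z$. Considering first exits from neighbourhoods of
  $C$ one sees that $K$ contains points at every small distance from $C$, so $K$ is uncountable.

  By choosing points one after the other, each much closer to $C$ than the previous ones, one
  obtains a countable set $P$ accumulating only at $C$ such that, for every $S \subseteq K$, some
  arbitrarily large times $l$ bring $f^l(P)$ close to $P \cup C \cup S$; periodicity makes the points chosen
  before return exactly, while the later ones are still close to $C$. Put
  $A_q = P \cup C \cup \{f^k(q)\}_k$ for $q \in K$. Taking $S = \emptyset$ shows that $A_q$ is recurrent.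
  With $S = K$ all the sets $A_q$ become close to $P \cup K$ at the same times, so they are
  pairwise proximal, their limit sets meet, and they are not almost periodic. With $S = \{y\}$ one
  obtains $A_q \cup \{y\}$ in the limit set of $A_q$, and it is not in that of $A_{q'}$ unless it contains $q'$.

  If $f$ is equicontinuous, then so is the induced map on the hyperspace, and its orbits are almost
  periodic since multiples of a common period of a fine finite net move no point far.
\<close>

section \<open>Iterates, and lower and upper limits of nonnegative sequences\<close>

lemma funpow_mult_fixed: "(g ^^ n) x = x \<Longrightarrow> (g ^^ (k * n)) x = x"
  by (induction k) (simp_all add: funpow_add)

text \<open>Rounds a time up to a multiple of \<open>L\<close> at the cost of between 1 and
  \<open>L\<close> further steps.\<close>

lemma add_diff_mod_eq:
  fixes n L :: nat
  assumes "L \<ge> 1"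
  shows "n + (L - n mod L) = (n div L + 1) * L"
proof -
  have "n mod L < L" using assms by simp
  moreover have "n div L * L + n mod L = n" by simp
  moreover have "(n div L + 1) * L = n div L * L + L" by simp
  ultimately show ?thesis by linarith
qed

lemma funpow_image:
  fixes g :: "'b \<Rightarrow> 'b"
  shows "(image g ^^ n) A = (g ^^ n) ` A"
  by (induction n) (auto simp: image_image)

lemma liminf_eq_0_iff:
  fixes a :: "nat \<Rightarrow> real"
  assumes "\<And>n. 0 \<le> a n"
  shows "liminf (\<lambda>n. ereal (a n)) = 0 \<longleftrightarrow> (\<forall>e>0. \<forall>N. \<exists>n\<ge>N. a n < e)"
proof
  assume l: "liminf (\<lambda>n. ereal (a n)) = 0"
  show "\<forall>e>0. \<forall>N. \<exists>n\<ge>N. a n < e"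
  proof (rule ccontr)
    assume "\<not> ?thesis"
    then obtain e N where "e > 0" "\<And>n. n \<ge> N \<Longrightarrow> e \<le> a n" by (meson not_le)
    then have "ereal e \<le> liminf (\<lambda>n. ereal (a n))"
      by (intro Liminf_bounded) (auto simp: eventually_sequentially)
    with l \<open>e > 0\<close> show False by simp
  qed
next
  assume h: "\<forall>e>0. \<forall>N. \<exists>n\<ge>N. a n < e"
  have "\<not> 0 < liminf (\<lambda>n. ereal (a n))"
  proof
    assume "0 < liminf (\<lambda>n. ereal (a n))"
    then obtain e where e: "0 < ereal e" "ereal e < liminf (\<lambda>n. ereal (a n))"
      using ereal_dense2 by blast
    obtain N where "\<And>n. n \<ge> N \<Longrightarrow> e < a n"
      using less_LiminfD[OF e(2)] by (auto simp: eventually_sequentially)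
    then show False using h e(1) by (metis ereal_less(2) less_asym)
  qed
  moreover have "liminf (\<lambda>n. ereal (a n)) \<ge> 0"
    using assms by (intro Liminf_bounded) auto
  ultimately show "liminf (\<lambda>n. ereal (a n)) = 0" by simp
qed

lemma limsup_eq_0_iff:
  fixes a :: "nat \<Rightarrow> real"
  assumes "\<And>n. 0 \<le> a n"
  shows "limsup (\<lambda>n. ereal (a n)) = 0 \<longleftrightarrow> a \<longlonglongrightarrow> 0"
proof
  assume l: "limsup (\<lambda>n. ereal (a n)) = 0"
  have "liminf (\<lambda>n. ereal (a n)) \<ge> 0"
    using assms by (intro Liminf_bounded) auto
  moreover have "liminf (\<lambda>n. ereal (a n)) \<le> limsup (\<lambda>n. ereal (a n))"
    by (intro Liminf_le_Limsup) auto
  ultimately have "(\<lambda>n. ereal (a n)) \<longlonglongrightarrow> ereal 0"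
    using l by (intro Liminf_eq_Limsup) (auto simp: zero_ereal_def)
  then show "a \<longlonglongrightarrow> 0" by simp
next
  assume "a \<longlonglongrightarrow> 0"
  then have "(\<lambda>n. ereal (a n)) \<longlonglongrightarrow> ereal 0" by simp
  then show "limsup (\<lambda>n. ereal (a n)) = 0"
    by (simp add: lim_imp_Limsup zero_ereal_def)
qed

section \<open>Pointwise periodic homeomorphisms of a compact metric space\<close>

locale periodic_homeo = Metric_space X d for X :: "'a set" and d +
  fixes f h :: "'a \<Rightarrow> 'a"
  assumes compact: "compact_space mtopology"
    and homeo: "homeomorphic_maps mtopology mtopology f h"
    and periodic: "pointwise_periodic X f"
begin

lemma f_in: "x \<in> X \<Longrightarrow> f x \<in> X"
  using homeo unfolding homeomorphic_maps_def continuous_map_def by auto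

lemma pow_in [simp]: "x \<in> X \<Longrightarrow> (f ^^ n) x \<in> X"
  by (induction n) (auto simp: f_in)

lemma hpow_pow [simp]: "x \<in> X \<Longrightarrow> (h ^^ n) ((f ^^ n) x) = x"
  \<comment> \<open>The instance of \<open>funpow_swap1\<close> moves one \<open>h\<close> inwards,
    next to the outermost \<open>f\<close>, where the two cancel.\<close>
  using homeo by (induction n) (simp_all add: funpow_swap1[of h _ "f _"] homeomorphic_maps_def)

lemma continuous_pow: "continuous_map mtopology mtopology (f ^^ n)"
proof (induction n)
  case 0
  have "(f ^^ 0) = id" by auto
  then show ?case by simp
next
  case (Suc n)
  moreover have "continuous_map mtopology mtopology f"
    using homeo by (simp add: homeomorphic_maps_def)
  ultimately show ?case
    using continuous_map_compose by (subst funpow.simps(2)) blast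
qed

lemma continuous_hpow: "continuous_map mtopology mtopology (h ^^ n)"
proof (induction n)
  case 0
  have "(h ^^ 0) = id" by auto
  then show ?case by simp
next
  case (Suc n)
  moreover have "continuous_map mtopology mtopology h"
    using homeo by (simp add: homeomorphic_maps_def)
  ultimately show ?case
    using continuous_map_compose by (subst funpow.simps(2)) blast
qed

lemma pow_cont:
  assumes "x \<in> X" "e > 0"
  obtains r where "r > 0" "\<And>y. y \<in> X \<Longrightarrow> d x y < r \<Longrightarrow> d ((f ^^ n) x) ((f ^^ n) y) < e"
proof -
  obtain r where "r > 0"
    "\<forall>y. y \<in> X \<and> d x y < r \<longrightarrow> d ((f ^^ n) x) ((f ^^ n) y) < e"
    using assms continuous_pow[of n] unfolding metric_continuous_map[OF Metric_space_axioms]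
    by (elim conjE ballE[of _ _ x] allE[of _ e] impE) auto
  then show ?thesis using that by blast
qed

text \<open>Continuity of the backward iterates is what allows \<open>exit_point\<close> to follow
  an accumulation of points back in time.\<close>

lemma hpow_cont:
  assumes "x \<in> X" "e > 0"
  obtains r where "r > 0" "\<And>y. y \<in> X \<Longrightarrow> d x y < r \<Longrightarrow> d ((h ^^ n) x) ((h ^^ n) y) < e"
proof -
  obtain r where "r > 0"
    "\<forall>y. y \<in> X \<and> d x y < r \<longrightarrow> d ((h ^^ n) x) ((h ^^ n) y) < e"
    using assms continuous_hpow[of n] unfolding metric_continuous_map[OF Metric_space_axioms]
    by (elim conjE ballE[of _ _ x] allE[of _ e] impE) auto
  then show ?thesis using that by blast
qed

lemma pow_cont_upto:
  assumes "x \<in> X" "e > 0"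
  shows "\<exists>r>0. \<forall>y\<in>X. d x y < r \<longrightarrow> (\<forall>j\<le>N. d ((f ^^ j) x) ((f ^^ j) y) < e)"
proof (induction N)
  case 0
  show ?case using assms by auto
next
  case (Suc N)
  then obtain r where r: "r > 0" "\<forall>y\<in>X. d x y < r \<longrightarrow> (\<forall>j\<le>N. d ((f ^^ j) x) ((f ^^ j) y) < e)"
    by blast
  obtain s where "s > 0" "\<And>y. y \<in> X \<Longrightarrow> d x y < s \<Longrightarrow> d ((f ^^ Suc N) x) ((f ^^ Suc N) y) < e"
    using pow_cont[OF assms] by metis
  with r show ?case
    by (intro exI[of _ "min r s"]) (auto simp: le_Suc_eq)
qed

lemma pow_cont_finite:
  assumes "finite Q" "Q \<subseteq> X" "e > 0"
  obtains r where "r > 0"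
    "\<And>z y j. z \<in> Q \<Longrightarrow> y \<in> X \<Longrightarrow> d z y < r \<Longrightarrow> j \<le> N \<Longrightarrow> d ((f ^^ j) z) ((f ^^ j) y) < e"
proof -
  have "\<exists>r>0. \<forall>z\<in>Q. \<forall>y\<in>X. d z y < r \<longrightarrow> (\<forall>j\<le>N. d ((f ^^ j) z) ((f ^^ j) y) < e)"
    using assms(1,2)
  proof (induction Q)
    case (insert x Q)
    then obtain r where r: "r > 0"
      "\<forall>z\<in>Q. \<forall>y\<in>X. d z y < r \<longrightarrow> (\<forall>j\<le>N. d ((f ^^ j) z) ((f ^^ j) y) < e)" by auto
    obtain s where "s > 0" "\<forall>y\<in>X. d x y < s \<longrightarrow> (\<forall>j\<le>N. d ((f ^^ j) x) ((f ^^ j) y) < e)"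
      using pow_cont_upto[of x e N] insert.prems assms(3) by auto
    with r show ?case by (intro exI[of _ "min r s"]) simp
  qed (use zero_less_one in blast)
  then show ?thesis using that by blast
qed

text \<open>Sequential compactness phrased without a subsequence: later arguments only pick one
  sufficiently late term close to the cluster point.\<close>

lemma cluster_point:
  fixes s :: "nat \<Rightarrow> 'a"
  assumes "\<And>n. s n \<in> X"
  obtains l where "l \<in> X" "\<And>e N. e > 0 \<Longrightarrow> \<exists>n\<ge>N. d l (s n) < e"
proof -
  have "range s \<subseteq> X" using assms by auto
  then obtain l and r :: "nat \<Rightarrow> nat" where l: "l \<in> X" "strict_mono r" "limitin mtopology (s \<circ> r) l sequentially"
    using compact unfolding compact_space_def topspace_mtopology compactin_sequentially by meson
  show ?thesis
  proof (rule that[OF l(1)])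
    fix e :: real and N :: nat assume "e > 0"
    then obtain M where M: "\<And>n. n \<ge> M \<Longrightarrow> d (s (r n)) l < e"
      using l(3) unfolding limit_metric_sequentially comp_def by meson
    have "r (max M N) \<ge> N" using seq_suble[OF l(2), of "max M N"] by linarith
    then show "\<exists>n\<ge>N. d l (s n) < e" using M[of "max M N"] commute by auto
  qed
qed

lemma finite_net:
  assumes "Y \<subseteq> X" "e > 0"
  obtains N where "finite N" "N \<subseteq> Y" "\<And>y. y \<in> Y \<Longrightarrow> \<exists>z\<in>N. d z y < e"
proof -
  have "mtotally_bounded Y"
    using compactin_imp_mtotally_bounded[of X] compact mtotally_bounded_subset assms(1)
    by (auto simp: compact_space_def)
  then have "\<exists>N. finite N \<and> N \<subseteq> Y \<and> Y \<subseteq> (\<Union>x\<in>N. mball x e)"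
    using assms(2) by (simp add: mtotally_bounded_def)
  then obtain N where "finite N" "N \<subseteq> Y" "Y \<subseteq> (\<Union>x\<in>N. mball x e)" by blast
  then show ?thesis by (intro that[of N]) (auto dest!: subsetD)
qed

lemma period:
  assumes "x \<in> X"
  obtains n where "n \<ge> 1" "(f ^^ n) x = x"
  using periodic assms unfolding pointwise_periodic_def by blast

text \<open>A product of periods of the points of \<open>Q\<close> serves.\<close>

lemma common_period:
  assumes "finite Q" "Q \<subseteq> X"
  obtains L where "L \<ge> 1" "\<And>a. a \<in> Q \<Longrightarrow> (f ^^ L) a = a"
proof -
  have "\<exists>L\<ge>1. \<forall>a\<in>Q. (f ^^ L) a = a"
    using assms
  proof (induction Q)
    case (insert x Q)
    then obtain L where L: "L \<ge> 1" "\<forall>a\<in>Q. (f ^^ L) a = a" by auto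
    obtain n where n: "n \<ge> 1" "(f ^^ n) x = x" using period insert.prems by auto
    have "(f ^^ (L * n)) x = x" using n by (intro funpow_mult_fixed)
    moreover have "(f ^^ (L * n)) a = a" if "a \<in> Q" for a
      using funpow_mult_fixed[of L f a n] L that by (simp add: mult.commute)
    ultimately show ?case using L n by (intro exI[of _ "L * n"]) auto
  qed auto
  then show ?thesis using that by auto
qed

definition orbit :: "'a \<Rightarrow> 'a set" where
  "orbit x = range (\<lambda>k. (f ^^ k) x)"

lemma self_in_orbit: "x \<in> orbit x"
  unfolding orbit_def by (intro range_eqI[of _ _ 0]) auto

lemma orbit_subset: "x \<in> X \<Longrightarrow> orbit x \<subseteq> X"
  by (auto simp: orbit_def)

lemma orbit_finite:
  assumes "x \<in> X"
  shows "finite (orbit x)"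
proof -
  obtain n where n: "n \<ge> 1" "(f ^^ n) x = x" using period assms by auto
  have "(f ^^ k) x = (f ^^ (k mod n)) x" for k
  proof -
    have "(f ^^ k) x = (f ^^ (k mod n)) ((f ^^ (k div n * n)) x)"
      by (metis add.commute div_mult_mod_eq funpow_add o_apply)
    then show ?thesis using funpow_mult_fixed[OF n(2)] by simp
  qed
  moreover have "k mod n < n" for k using n by simp
  ultimately have "orbit x \<subseteq> (\<lambda>k. (f ^^ k) x) ` {..<n}"
    unfolding orbit_def by blast
  then show ?thesis by (rule finite_subset) simp
qed

lemma f_orbit:
  assumes "x \<in> X"
  shows "f ` orbit x = orbit x"
proof -
  have sub: "f ` orbit x \<subseteq> orbit x"
  proof
    fix y assume "y \<in> f ` orbit x"
    then obtain k where "y = (f ^^ Suc k) x" by (auto simp: orbit_def)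
    then show "y \<in> orbit x" unfolding orbit_def by (rule range_eqI)
  qed
  obtain n where n: "n \<ge> 1" "(f ^^ n) x = x" using period assms by auto
  have "(f ^^ k) x \<in> f ` orbit x" for k
  proof -
    \<comment> \<open>The period \<open>n\<close> turns \<open>k\<close> into the successor
      \<open>k + n\<close>, so the point has a predecessor in the forward orbit.\<close>
    have "(f ^^ k) x = (f ^^ (k + (n - 1) + 1)) x"
      using n by (simp add: funpow_add)
    then show ?thesis by (auto simp: orbit_def)
  qed
  then show ?thesis using sub by (auto simp: orbit_def)
qed

lemma pow_orbit:
  assumes "x \<in> X"
  shows "(f ^^ n) ` orbit x = orbit x"
proof (induction n)
  case (Suc n)
  have "(f ^^ Suc n) ` orbit x = f ` (f ^^ n) ` orbit x"
    by (simp add: image_image)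
  then show ?case using f_orbit[OF assms] Suc by metis
qed simp

text \<open>Orbits are cycles: the orbit of \<open>y\<close> is the image under an iterate of the
  orbit of \<open>x\<close>, which \<open>pow_orbit\<close> shows to be invariant.\<close>

lemma orbit_eq:
  assumes "x \<in> X" "y \<in> orbit x"
  shows "orbit y = orbit x"
proof -
  obtain j where "y = (f ^^ j) x" using assms by (auto simp: orbit_def)
  then have "(f ^^ k) y = (f ^^ j) ((f ^^ k) x)" for k
    by (metis add.commute comp_apply funpow_add)
  then have "orbit y = (f ^^ j) ` orbit x"
    by (auto simp: orbit_def image_image)
  then show ?thesis using pow_orbit assms by simp
qed

subsection \<open>The induced map on the hyperspace\<close>

abbreviation "H \<equiv> hyperspace X d"
abbreviation "dH \<equiv> hausdorff_dist X d"

sublocale hyper: Metric_space H dH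
  by (rule Metric_space_hyperspace[OF Metric_space_axioms compact])

lemma H_sub: "A \<in> H \<Longrightarrow> A \<subseteq> X" and H_ne: "A \<in> H \<Longrightarrow> A \<noteq> {}"
  and H_closed: "A \<in> H \<Longrightarrow> closedin mtopology A"
  unfolding hyperspace_def using closedin_subset by fastforce+

lemma closedin_limit:
  assumes "closedin mtopology A" "x \<in> X" "\<And>e. e > 0 \<Longrightarrow> \<exists>a\<in>A. d x a < e"
  shows "x \<in> A"
proof (rule ccontr)
  assume "x \<notin> A"
  then obtain r where r: "r > 0" "disjnt A (mball x r)"
    using assms(1,2) unfolding closedin_metric by blast
  obtain a where "a \<in> A" "d x a < r" using assms(3)[OF r(1)] by blast
  moreover have "A \<subseteq> X" using assms(1) closedin_subset by fastforce
  ultimately show False using r assms(2) by (auto simp: disjnt_iff)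
qed

text \<open>The bound is not strict, because a supremum of values below \<open>e\<close> may equal
  \<open>e\<close>. Strict bounds are obtained by applying this with \<open>e / 2\<close>.\<close>

lemma hausdorff_le:
  assumes A: "A \<in> H" and B: "B \<in> H"
    and AB: "\<And>a. a \<in> A \<Longrightarrow> \<exists>b\<in>B. d a b \<le> e" and BA: "\<And>b. b \<in> B \<Longrightarrow> \<exists>a\<in>A. d a b \<le> e"
  shows "dH A B \<le> e"
proof -
  have bdd: "bdd_below (d a ` B)" "bdd_below ((\<lambda>x. d x b) ` A)" for a b
    by (rule bdd_belowI2[of _ 0]; simp)+
  have "(SUP a\<in>A. INF b\<in>B. d a b) \<le> e"
  proof (rule cSUP_least[OF H_ne[OF A]])
    fix a assume "a \<in> A"
    then obtain b where "b \<in> B" "d a b \<le> e" using AB by blast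
    then show "(INF b\<in>B. d a b) \<le> e" using cINF_lower[OF bdd(1)] by (meson order_trans)
  qed
  moreover have "(SUP b\<in>B. INF a\<in>A. d a b) \<le> e"
  proof (rule cSUP_least[OF H_ne[OF B]])
    fix b assume "b \<in> B"
    then obtain a where "a \<in> A" "d a b \<le> e" using BA by blast
    then show "(INF a\<in>A. d a b) \<le> e" using cINF_lower[OF bdd(2)] by (meson order_trans)
  qed
  ultimately show ?thesis using A B by (simp add: hausdorff_dist_def)
qed

lemma hausdorff_lessD:
  assumes A: "A \<in> H" and B: "B \<in> H" and "dH A B < e" "a \<in> A"
  obtains b where "b \<in> B" "d a b < e"
proof -
  \<comment> \<open>A real supremum dominates its terms only for a family bounded above; compactness
    supplies the bound.\<close>
  have "mbounded X"
    using compact compactin_imp_mbounded by (simp add: compact_space_def)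
  then obtain k where k: "\<And>x y. x \<in> X \<Longrightarrow> y \<in> X \<Longrightarrow> d x y \<le> k"
    unfolding mbounded_alt by blast
  have bdd: "bdd_below (d a ` B)" for a
    by (rule bdd_belowI2[of _ 0]) simp
  obtain b0 where b0: "b0 \<in> B" using H_ne[OF B] by blast
  have "bdd_above ((\<lambda>a. INF b\<in>B. d a b) ` A)"
  proof (rule bdd_aboveI2[of _ _ k])
    fix x assume "x \<in> A"
    then show "(INF b\<in>B. d x b) \<le> k"
      using cINF_lower[OF bdd b0, of x] k[of x b0] H_sub[OF A] H_sub[OF B] b0 by fastforce
  qed
  then have "(INF b\<in>B. d a b) \<le> (SUP a\<in>A. INF b\<in>B. d a b)" by (rule cSUP_upper[OF \<open>a \<in> A\<close>])
  also have "\<dots> \<le> dH A B" using A B by (simp add: hausdorff_dist_def)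
  finally have "(INF b\<in>B. d a b) < e" using assms by simp
  then show ?thesis using that cINF_less_iff[OF H_ne[OF B] bdd] by blast
qed

lemma pow_image_H [simp]:
  assumes "A \<in> H"
  shows "(f ^^ n) ` A \<in> H"
proof -
  have "closed_map mtopology mtopology (f ^^ n)"
    using continuous_imp_closed_map[OF continuous_pow compact Hausdorff_space_mtopology] .
  then show ?thesis using assms by (auto simp: closed_map_def hyperspace_def)
qed

lemma pow_image_add: "(f ^^ (m + n)) ` A = (f ^^ m) ` (f ^^ n) ` A"
  by (simp add: funpow_add image_comp)

lemma omega_limit_iff:
  assumes "A \<in> H"
  shows "D \<in> omega_limit H dH (image f) A \<longleftrightarrow>
    D \<in> H \<and> (\<forall>e>0. \<forall>N. \<exists>k\<ge>N. dH ((f ^^ k) ` A) D < e)"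
proof -
  have "D \<in> hyper.mtopology closure_of {(image f ^^ k) A |k. k \<ge> N} \<longleftrightarrow>
      D \<in> H \<and> (\<forall>e>0. \<exists>k\<ge>N. dH ((f ^^ k) ` A) D < e)" for N
  proof -
    have "(\<exists>y\<in>{(image f ^^ k) A |k. k \<ge> N}. y \<in> hyper.mball D e) \<longleftrightarrow>
        (\<exists>k\<ge>N. dH ((f ^^ k) ` A) D < e)" if "D \<in> H" for e
      using pow_image_H[OF assms] that by (auto simp: funpow_image hyper.commute[of D])
    then show ?thesis unfolding hyper.metric_closure_of by blast
  qed
  then show ?thesis unfolding omega_limit_def by blast
qed

text \<open>The orbit of a periodic point is finite, hence closed, and contains the limit set. An
  uncountable limit set thus excludes periodicity.\<close>

lemma countable_omega_limit_periodic:
  assumes "A \<in> H" "n \<ge> 1" "(f ^^ n) ` A = A"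
  shows "countable (omega_limit H dH (image f) A)"
proof -
  let ?F = "(\<lambda>k. (f ^^ k) ` A) ` {..<n}"
  have "(f ^^ k) ` A \<in> ?F" for k
  proof -
    have "(f ^^ (k div n * n)) ` A = A"
      using funpow_mult_fixed[of n "image f" A] assms(3) by (simp add: funpow_image)
    then have "(f ^^ k) ` A = (f ^^ (k mod n)) ` A"
      using pow_image_add[of "k mod n" "k div n * n" A] by simp
    moreover have "k mod n < n" using assms(2) by simp
    ultimately show ?thesis by blast
  qed
  then have "{(image f ^^ k) A |k. k \<ge> 0} \<subseteq> ?F" by (auto simp: funpow_image)
  moreover have "closedin hyper.mtopology ?F"
    using closedin_Hausdorff_finite[OF hyper.Hausdorff_space_mtopology] assms(1)
    by (auto simp: image_subset_iff)
  ultimately have "hyper.mtopology closure_of {(image f ^^ k) A |k. k \<ge> 0} \<subseteq> ?F"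
    by (rule closure_of_minimal)
  moreover have "omega_limit H dH (image f) A
      \<subseteq> hyper.mtopology closure_of {(image f ^^ k) A |k. k \<ge> 0}"
    unfolding omega_limit_def by blast
  ultimately have "omega_limit H dH (image f) A \<subseteq> ?F" by (rule subset_trans[rotated])
  then show ?thesis by (rule countable_subset) (simp add: countable_finite)
qed

lemma proximal_iff:
  "proximal dH (image f) A B \<longleftrightarrow> (\<forall>e>0. \<forall>N. \<exists>n\<ge>N. dH ((f ^^ n) ` A) ((f ^^ n) ` B) < e)"
  unfolding proximal_def funpow_image by (rule liminf_eq_0_iff) simp

lemma asymptotic_iff:
  "asymptotic dH (image f) A B \<longleftrightarrow> (\<lambda>n. dH ((f ^^ n) ` A) ((f ^^ n) ` B)) \<longlonglongrightarrow> 0"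
  unfolding asymptotic_def funpow_image by (rule limsup_eq_0_iff) simp

end

subsection \<open>Limit points of orbits starting close to a cycle\<close>

text \<open>\<open>C\<close> stands for a cycle but enters as a finite invariant set;
  \<open>not_equicontinuous_imp_chaotic_family\<close> instantiates it with an orbit.\<close>

locale periodic_homeo_core = periodic_homeo X d f h
  for X :: "'a set" and d and f h :: "'a \<Rightarrow> 'a" +
  fixes C :: "'a set"
  assumes C_fin: "finite C" and C_ne: "C \<noteq> {}" and C_sub: "C \<subseteq> X" and C_inv: "f ` C = C"
begin

text \<open>The distance to \<open>C\<close>. As \<open>C\<close> is finite, the minimum is
  attained, see \<open>rho_witness\<close>.\<close>

definition rho :: "'a \<Rightarrow> real" where "rho u = Min (d u ` C)"

lemma rho_le: "c \<in> C \<Longrightarrow> rho u \<le> d u c"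
  unfolding rho_def using C_fin by (intro Min_le) auto

lemma rho_witness: obtains c where "c \<in> C" "rho u = d u c"
proof -
  have "Min (d u ` C) \<in> d u ` C" using C_fin C_ne by (intro Min_in) auto
  then show ?thesis using that unfolding rho_def by blast
qed

lemma rho_nonneg: "0 \<le> rho u"
  by (metis rho_witness nonneg)

lemma rho_triangle:
  assumes "u \<in> X" "v \<in> X"
  shows "rho u \<le> d u v + rho v"
proof -
  obtain c where c: "c \<in> C" "rho v = d v c" by (rule rho_witness)
  have "rho u \<le> d u c" by (rule rho_le[OF c(1)])
  also have "\<dots> \<le> d u v + d v c" using c C_sub assms by (intro triangle) auto
  finally show ?thesis using c by simp
qed

lemma rho_less_iff: "rho u < e \<longleftrightarrow> (\<exists>c\<in>C. d u c < e)"
  by (metis rho_le rho_witness order_le_less_trans)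

lemma rho_eq_0: "u \<in> X \<Longrightarrow> rho u = 0 \<longleftrightarrow> u \<in> C"
  by (metis C_sub mdist_zero rho_le rho_nonneg rho_witness subsetD order_antisym zero)

lemma C_pow: "c \<in> C \<Longrightarrow> (f ^^ n) c \<in> C"
  using C_inv by (induction n) auto

lemma C_pow_image: "(f ^^ n) ` C = C"
proof (induction n)
  case (Suc n)
  have "(f ^^ Suc n) ` C = f ` (f ^^ n) ` C" by (simp add: image_image)
  then show ?case using C_inv Suc by metis
qed simp

lemma rho_pow_small:
  assumes "e > 0"
  obtains r where "r > 0" "\<And>u j. u \<in> X \<Longrightarrow> rho u < r \<Longrightarrow> j \<le> N \<Longrightarrow> rho ((f ^^ j) u) < e"
proof -
  obtain r where r: "r > 0"
    "\<And>c y j. c \<in> C \<Longrightarrow> y \<in> X \<Longrightarrow> d c y < r \<Longrightarrow> j \<le> N \<Longrightarrow> d ((f ^^ j) c) ((f ^^ j) y) < e"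
    by (rule pow_cont_finite[OF C_fin C_sub assms]) (rule that)
  show ?thesis
  proof (rule that[OF r(1)])
    fix u j assume u: "u \<in> X" "rho u < r" "j \<le> N"
    then obtain c where c: "c \<in> C" "d u c < r" unfolding rho_less_iff by blast
    then have "d ((f ^^ j) c) ((f ^^ j) u) < e" using r(2) u commute by simp
    then show "rho ((f ^^ j) u) < e"
      using C_pow[OF c(1)] commute rho_less_iff by metis
  qed
qed

text \<open>An orbit that stays near \<open>C\<close> has to follow the point of \<open>C\<close>
  next to which it started: distinct points of \<open>C\<close> are at least \<open>s\<close> apart,
  and one application of \<open>f\<close> cannot carry a nearby point across that gap.\<close>

lemma stable_imp_equicontinuous_at:
  assumes stable: "\<And>e. e > 0 \<Longrightarrow> \<exists>r>0. \<forall>u\<in>X. rho u < r \<longrightarrow> (\<forall>k. rho ((f ^^ k) u) < e)"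
    and "x \<in> C" "e > 0"
  shows "\<exists>r>0. \<forall>n. \<forall>y\<in>X. d x y < r \<longrightarrow> d ((f ^^ n) x) ((f ^^ n) y) < e"
proof -
  obtain s where s: "s > 0" "\<And>a b. a \<in> C \<Longrightarrow> b \<in> C \<Longrightarrow> a \<noteq> b \<Longrightarrow> s \<le> d a b"
  proof
    \<comment> \<open>The added 1 keeps the set nonempty when \<open>C\<close> has a single
      point.\<close>
    let ?D = "insert 1 ((\<lambda>(a, b). d a b) ` {p \<in> C \<times> C. fst p \<noteq> snd p})"
    have fin: "finite ?D" using C_fin by simp
    have "0 < d a b" if "a \<in> C" "b \<in> C" "a \<noteq> b" for a b
      using that C_sub mdist_pos_eq[of a b] by blast
    then show "Min ?D > 0" using fin by (subst Min_gr_iff) auto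
    show "Min ?D \<le> d a b" if "a \<in> C" "b \<in> C" "a \<noteq> b" for a b
      using fin that by (intro Min_le) auto
  qed
  obtain t where t: "t > 0"
    "\<And>c y j. c \<in> C \<Longrightarrow> y \<in> X \<Longrightarrow> d c y < t \<Longrightarrow> j \<le> 1 \<Longrightarrow> d ((f ^^ j) c) ((f ^^ j) y) < s / 2"
    using pow_cont_finite[OF C_fin C_sub half_gt_zero[OF s(1)], of 1] by metis
  \<comment> \<open>The three bounds: \<open>e\<close> is the tolerance asked for,
    \<open>s / 2\<close> makes the nearby point of \<open>C\<close> unique, and \<open>t\<close>
    limits what one application of \<open>f\<close> can do to the distance.\<close>
  define e1 where "e1 = min (min e (s / 2)) t"
  have e1: "e1 > 0" "e1 \<le> e" "e1 \<le> s / 2" "e1 \<le> t"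
    unfolding e1_def using s(1) t(1) assms by auto
  obtain r where r: "r > 0" "\<And>u k. u \<in> X \<Longrightarrow> rho u < r \<Longrightarrow> rho ((f ^^ k) u) < e1"
    using stable[OF e1(1)] by blast
  have "d ((f ^^ n) x) ((f ^^ n) y) < e1" if y: "y \<in> X" "d x y < min r e1" for n y
  proof (induction n)
    case 0
    show ?case using y by simp
  next
    case (Suc n)
    let ?a = "(f ^^ Suc n) x" and ?b = "(f ^^ Suc n) y"
    have aC: "?a \<in> C" "(f ^^ n) x \<in> C" using C_pow assms(2) by blast+
    have "rho y < r" using y assms(2) commute rho_less_iff by (metis min_less_iff_conj)
    then obtain c where c: "c \<in> C" "d ?b c < e1" using r y rho_less_iff by blast
    have "d ((f ^^ n) x) ((f ^^ n) y) < t" using Suc e1(4) by linarith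
    then have "d ?a ?b < s / 2" using t(2)[OF aC(2), of _ 1] y by simp
    moreover have "d ?a c \<le> d ?a ?b + d ?b c"
      using aC c C_sub y by (intro triangle) (auto simp del: funpow.simps)
    ultimately have "d ?a c < s" using c e1 by linarith
    then have "?a = c" using s(2)[of ?a c] aC c by fastforce
    then show ?case using c commute by metis
  qed
  then have "d ((f ^^ n) x) ((f ^^ n) y) < e" if "y \<in> X" "d x y < min r e1" for n y
    using e1(2) that by (meson less_le_trans)
  then show ?thesis using r(1) e1(1) by (intro exI[of _ "min r e1"]) auto
qed

text \<open>Points approached by orbits that start ever closer to \<open>C\<close>, along the
  multiples of each \<open>L\<close>. The multiples matter in \<open>steering_step\<close>: at times
  \<open>k * L\<close> every point fixed by \<open>f ^^ L\<close> is back in place.\<close>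

definition K :: "'a set" where
  "K = {z \<in> X. \<forall>L\<ge>1. \<forall>r>0. \<exists>u\<in>X. \<exists>k. rho u < r \<and> d ((f ^^ (k * L)) u) z < r}"

lemma K_sub: "K \<subseteq> X" by (auto simp: K_def)

lemma KD:
  assumes "z \<in> K" "L \<ge> 1" "r > 0"
  obtains u k where "u \<in> X" "rho u < r" "d ((f ^^ (k * L)) u) z < r"
  using assms unfolding K_def by blast

lemma K_limit:
  assumes "z \<in> X" and w: "\<And>e. e > 0 \<Longrightarrow> \<exists>w\<in>K. d w z < e"
  shows "z \<in> K"
  unfolding K_def
proof (intro CollectI conjI allI impI)
  fix L :: nat and r :: real assume L: "1 \<le> L" "0 < r"
  obtain w where w: "w \<in> K" "d w z < r / 2" using w[of "r / 2"] L by auto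
  obtain u k where u: "u \<in> X" "rho u < r / 2" "d ((f ^^ (k * L)) u) w < r / 2"
    using KD[OF w(1) L(1), of "r / 2"] L by auto
  have "d ((f ^^ (k * L)) u) z \<le> d ((f ^^ (k * L)) u) w + d w z"
    using u w K_sub assms(1) by (intro triangle) auto
  then show "\<exists>u\<in>X. \<exists>k. rho u < r \<and> d ((f ^^ (k * L)) u) z < r"
    using u w L by (intro bexI[of _ u] exI[of _ k]) auto
qed fact

text \<open>\<open>f ^^ n\<close> commutes with \<open>f ^^ (k * L)\<close> and, by continuity,
  keeps starting points close to the invariant set \<open>C\<close>.\<close>

lemma K_pow:
  assumes "z \<in> K"
  shows "(f ^^ n) z \<in> K"
proof -
  have zX: "z \<in> X" using assms K_sub by auto
  have "\<exists>u\<in>X. \<exists>k. rho u < r \<and> d ((f ^^ (k * L)) u) ((f ^^ n) z) < r" if L: "L \<ge> 1" "r > 0" for L r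
  proof -
    obtain s where s: "s > 0" "\<And>y. y \<in> X \<Longrightarrow> d z y < s \<Longrightarrow> d ((f ^^ n) z) ((f ^^ n) y) < r"
      using pow_cont[OF zX L(2)] by metis
    obtain t where t: "t > 0" "\<And>u. u \<in> X \<Longrightarrow> rho u < t \<Longrightarrow> rho ((f ^^ n) u) < r"
      using rho_pow_small[OF L(2)] by (metis le_refl)
    obtain u k where u: "u \<in> X" "rho u < min s t" "d ((f ^^ (k * L)) u) z < min s t"
      using KD[OF assms L(1), of "min s t"] s t by auto
    have "d ((f ^^ n) z) ((f ^^ n) ((f ^^ (k * L)) u)) < r"
      using u commute by (intro s) auto
    moreover have "(f ^^ n) ((f ^^ (k * L)) u) = (f ^^ (k * L)) ((f ^^ n) u)"
      by (metis add.commute comp_apply funpow_add)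
    ultimately show ?thesis using u t commute
      by (intro bexI[of _ "(f ^^ n) u"] exI[of _ k]) auto
  qed
  then show ?thesis using zX unfolding K_def by auto
qed

text \<open>The point is that \<open>e\<close> is chosen before \<open>L\<close>. It comes from a
  cluster point \<open>z\<close> of the escaped points: the orbit of \<open>z\<close> is a cycle
  away from \<open>C\<close>, so an orbit passing close to \<open>z\<close> stays away from
  \<open>C\<close> for the next \<open>L\<close> steps, one of which falls on a multiple of
  \<open>L\<close>.\<close>

lemma unstable_uniform:
  assumes "e0 > 0" and unstable: "\<And>r. r > 0 \<Longrightarrow> \<exists>u\<in>X. \<exists>k. rho u < r \<and> e0 \<le> rho ((f ^^ k) u)"
  obtains e where "e > 0"
    "\<And>L r. L \<ge> 1 \<Longrightarrow> r > 0 \<Longrightarrow> \<exists>u\<in>X. \<exists>k. rho u < r \<and> e \<le> rho ((f ^^ (k * L)) u)"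
proof -
  have "\<forall>n. \<exists>u k. u \<in> X \<and> rho u < 1 / real (Suc n) \<and> e0 \<le> rho ((f ^^ k) u)"
    using unstable by (meson zero_less_divide_1_iff of_nat_0_less_iff zero_less_Suc)
  then obtain u k where u: "\<And>n. u n \<in> X" "\<And>n. rho (u n) < 1 / real (Suc n)"
    "\<And>n. e0 \<le> rho ((f ^^ k n) (u n))" by metis
  obtain z where z: "z \<in> X" "\<And>e N. e > 0 \<Longrightarrow> \<exists>n\<ge>N. d z ((f ^^ k n) (u n)) < e"
    using cluster_point[of "\<lambda>n. (f ^^ k n) (u n)"] u by auto
  have zr: "rho z \<ge> e0"
  proof (rule field_le_epsilon)
    fix e :: real assume "e > 0"
    then obtain n where n: "d z ((f ^^ k n) (u n)) < e" using z by blast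
    have "rho ((f ^^ k n) (u n)) \<le> d ((f ^^ k n) (u n)) z + rho z"
      using z u by (intro rho_triangle) auto
    then show "e0 \<le> rho z + e" using n commute[of z] u(3)[of n] by simp
  qed
  \<comment> \<open>By periodicity \<open>z\<close> lies on the forward orbit of each
    \<open>w\<close>, so the invariant set \<open>C\<close> would contain \<open>z\<close> along
    with \<open>w\<close>.\<close>
  have notC: "w \<notin> C" if w: "w \<in> orbit z" for w
  proof
    assume "w \<in> C"
    obtain j where "z = (f ^^ j) w" 
      using orbit_eq[OF z(1) w] self_in_orbit[of z] by (auto simp: orbit_def)
    then have "z \<in> C" using C_pow \<open>w \<in> C\<close> by blast
    then show False using zr assms(1) rho_eq_0[OF z(1)] by simp
  qed
  have pos: "rho w > 0" if "w \<in> orbit z" for w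
    using notC[OF that] rho_eq_0[of w] rho_nonneg[of w] orbit_subset[OF z(1)] that by fastforce
  define e where "e = Min (rho ` orbit z) / 2"
  have fin: "finite (orbit z)" "orbit z \<noteq> {}" using orbit_finite[OF z(1)] self_in_orbit[of z] by auto
  have e: "e > 0" "\<And>w. w \<in> orbit z \<Longrightarrow> 2 * e \<le> rho w"
    unfolding e_def using fin pos by auto
  show ?thesis
  proof (rule that[OF e(1)], rule ccontr)
    fix L :: nat and r :: real assume L: "L \<ge> 1" "r > 0"
    assume "\<not> (\<exists>u\<in>X. \<exists>k. rho u < r \<and> e \<le> rho ((f ^^ (k * L)) u))"
    then have stab: "\<And>u k. u \<in> X \<Longrightarrow> rho u < r \<Longrightarrow> rho ((f ^^ (k * L)) u) < e" by (meson not_le)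
    obtain s where s: "s > 0" "\<And>y j. y \<in> X \<Longrightarrow> d z y < s \<Longrightarrow> j \<le> L \<Longrightarrow> d ((f ^^ j) z) ((f ^^ j) y) < e"
      using pow_cont_upto[OF z(1) e(1)] by meson
    obtain N where N: "1 / real (Suc N) < r" using nat_approx_posE[OF L(2)] by blast
    obtain n where n: "n \<ge> N" "d z ((f ^^ k n) (u n)) < s" using z(2)[OF s(1)] by blast
    have "1 / real (Suc n) \<le> 1 / real (Suc N)" using n by (intro divide_left_mono) auto
    then have un: "rho (u n) < r" using u(2)[of n] N by linarith
    \<comment> \<open>Rounding \<open>k n\<close> up to a multiple of \<open>L\<close> takes at most
      \<open>L\<close> steps, which is the range covered by \<open>s\<close>. The iterate reached is
      within \<open>e\<close> of \<open>C\<close> by \<open>stab\<close> and within \<open>e\<close>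
      of the orbit of \<open>z\<close>, although that orbit keeps distance \<open>2 * e\<close> from
      \<open>C\<close>.\<close>
    define j where "j = L - k n mod L"
    have j: "j \<le> L" "k n + j = (k n div L + 1) * L"
      unfolding j_def using add_diff_mod_eq[OF L(1)] by simp_all
    have "(f ^^ j) ((f ^^ k n) (u n)) = (f ^^ ((k n div L + 1) * L)) (u n)"
      using j(2) by (metis add.commute comp_apply funpow_add)
    then have "rho ((f ^^ j) ((f ^^ k n) (u n))) < e"
      using stab[OF u(1) un, of "k n div L + 1"] by simp
    moreover have "d ((f ^^ j) z) ((f ^^ j) ((f ^^ k n) (u n))) < e"
      using n j u by (intro s) auto
    moreover have "rho ((f ^^ j) z) \<le> d ((f ^^ j) z) ((f ^^ j) ((f ^^ k n) (u n)))
        + rho ((f ^^ j) ((f ^^ k n) (u n)))"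
      using z u by (intro rho_triangle) auto
    moreover have "2 * e \<le> rho ((f ^^ j) z)" by (intro e(2)) (auto simp: orbit_def)
    ultimately show False by linarith
  qed
qed

text \<open>
  The points $y_n$ where orbits starting close to $C$ first leave the closed $r$-neighbourhood
  accumulate at some $y$. The backward orbit of $y$, which is periodic, stays in that
  neighbourhood; hence so does $y$ itself.
\<close>
lemma exit_point:
  assumes unstable: "\<And>s. s > 0 \<Longrightarrow> \<exists>u\<in>X. \<exists>k. rho u < s \<and> r < rho ((f ^^ (k * L)) u)"
    and "r > 0" "L \<ge> 1"
  obtains y where "y \<in> X" "rho y = r"
    "\<And>s. s > 0 \<Longrightarrow> \<exists>u\<in>X. \<exists>k. rho u < s \<and> d ((f ^^ (k * L)) u) y < s"
proof -
  have "\<forall>n. \<exists>u. u \<in> X \<and> rho u < 1 / real (Suc n) \<and> (\<exists>k. r < rho ((f ^^ (k * L)) u))"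
    using unstable by (meson zero_less_divide_1_iff of_nat_0_less_iff zero_less_Suc)
  then obtain u where u: "\<And>n. u n \<in> X" "\<And>n. rho (u n) < 1 / real (Suc n)"
    "\<And>n. \<exists>k. r < rho ((f ^^ (k * L)) (u n))" by metis
  define k where "k n = (LEAST k. r < rho ((f ^^ (k * L)) (u n)))" for n
  have k: "r < rho ((f ^^ (k n * L)) (u n))" for n
    unfolding k_def using LeastI_ex[OF u(3)] .
  have k_least: "rho ((f ^^ (i * L)) (u n)) \<le> r" if "i < k n" for i n
    using not_less_Least that unfolding k_def by (metis not_le)
  obtain y where y: "y \<in> X" "\<And>e N. e > 0 \<Longrightarrow> \<exists>n\<ge>N. d y ((f ^^ (k n * L)) (u n)) < e"
    using cluster_point[of "\<lambda>n. (f ^^ (k n * L)) (u n)"] u by auto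
  have small: "\<exists>N. \<forall>n\<ge>N. rho (u n) < s" if s: "s > 0" for s
  proof -
    obtain N where N: "1 / real (Suc N) < s" using nat_approx_posE[OF s] by blast
    have "rho (u n) < s" if "n \<ge> N" for n
    proof -
      have "1 / real (Suc n) \<le> 1 / real (Suc N)" using that by (intro divide_left_mono) auto
      then show ?thesis using u(2)[of n] N by linarith
    qed
    then show ?thesis by blast
  qed
  have "r \<le> rho y"
  proof (rule field_le_epsilon)
    fix e :: real assume "e > 0"
    then obtain n where n: "d y ((f ^^ (k n * L)) (u n)) < e" using y by blast
    have "rho ((f ^^ (k n * L)) (u n)) \<le> d ((f ^^ (k n * L)) (u n)) y + rho y"
      using y u by (intro rho_triangle) auto
    then show "r \<le> rho y + e" using n commute[of y] k[of n] by simp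
  qed
  moreover have "rho y \<le> r"
  proof (rule field_le_epsilon)
    fix e :: real assume e: "e > 0"
    obtain p where p: "p \<ge> 1" "(f ^^ p) y = y" using period y by blast
    \<comment> \<open>\<open>p * L\<close> is a period of \<open>y\<close> and also a whole number
      of blocks of length \<open>L\<close>, so going back by it stays among the times
      considered.\<close>
    then have yp: "(f ^^ (p * L)) y = y" using funpow_mult_fixed[of p f y L] by (simp add: mult.commute)
    then have hy: "(h ^^ (p * L)) y = y" using hpow_pow[OF y(1)] by metis
    obtain s where s: "s > 0"
      "\<And>w. w \<in> X \<Longrightarrow> d y w < s \<Longrightarrow> d ((h ^^ (p * L)) y) ((h ^^ (p * L)) w) < e"
      using hpow_cont[OF y(1) e] by metis
    obtain t where t: "t > 0" "\<And>u j. u \<in> X \<Longrightarrow> rho u < t \<Longrightarrow> j \<le> p * L \<Longrightarrow> rho ((f ^^ j) u) < r"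
      using rho_pow_small[OF \<open>r > 0\<close>] by metis
    obtain N where N: "\<And>n. n \<ge> N \<Longrightarrow> rho (u n) < t" using small[OF t(1)] by blast
    obtain n where n: "n \<ge> N" "d y ((f ^^ (k n * L)) (u n)) < s" using y(2)[OF s(1)] by blast
    \<comment> \<open>A start within \<open>t\<close> of \<open>C\<close> stays below
      \<open>r\<close> for \<open>p * L\<close> steps, so the exit comes later and there is room to
      go back by \<open>p\<close> blocks.\<close>
    have "k n > p"
    proof (rule ccontr)
      assume "\<not> k n > p"
      then have "k n * L \<le> p * L" by simp
      then have "rho ((f ^^ (k n * L)) (u n)) < r" using t N n u by blast
      then show False using k[of n] by simp
    qed
    define w where "w = (f ^^ ((k n - p) * L)) (u n)"
    have "rho w \<le> r" unfolding w_def using k_least[of "k n - p" n] p \<open>k n > p\<close> by simp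
    have "k n * L = p * L + (k n - p) * L" using \<open>k n > p\<close> by (simp flip: add_mult_distrib)
    then have "(f ^^ (k n * L)) (u n) = (f ^^ (p * L)) w"
      unfolding w_def by (metis comp_apply funpow_add)
    then have "(h ^^ (p * L)) ((f ^^ (k n * L)) (u n)) = w"
      using u by (simp add: w_def)
    then have "d y w < e" using s(2)[OF _ n(2)] u hy by simp
    moreover have "rho y \<le> d y w + rho w"
      using y u by (intro rho_triangle) (auto simp: w_def)
    ultimately show "rho y \<le> r + e" using \<open>rho w \<le> r\<close> by linarith
  qed
  ultimately have "rho y = r" by simp
  moreover have "\<exists>v\<in>X. \<exists>k. rho v < s \<and> d ((f ^^ (k * L)) v) y < s" if "s > 0" for s
    using small[OF that] y(2)[OF that] u(1) commute by metis
  ultimately show ?thesis using that y(1) by blast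
qed

text \<open>\<open>rho\<close> maps \<open>K\<close> onto a set containing the whole interval
  between 0 and \<open>e\<close>: exits from the closed \<open>r\<close>-neighbourhood give a point
  of \<open>K\<close> at distance exactly \<open>r\<close>.\<close>

lemma K_uncountable:
  assumes "e > 0"
    and unstable: "\<And>L s. L \<ge> 1 \<Longrightarrow> s > 0 \<Longrightarrow> \<exists>u\<in>X. \<exists>k. rho u < s \<and> e \<le> rho ((f ^^ (k * L)) u)"
  shows "uncountable K"
proof -
  have "r \<in> rho ` K" if r: "0 < r" "r < e" for r
  proof -
    have "\<exists>y. y \<in> X \<and> rho y = r \<and> (\<forall>s>0. \<exists>u\<in>X. \<exists>k. rho u < s \<and> d ((f ^^ (k * L)) u) y < s)"
      if L: "L \<ge> 1" for L
    proof -
      have "\<exists>u\<in>X. \<exists>k. rho u < s \<and> r < rho ((f ^^ (k * L)) u)" if "s > 0" for s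
        using unstable[OF L that] r(2) less_le_trans by blast
      then obtain y where "y \<in> X" "rho y = r"
        "\<And>s. s > 0 \<Longrightarrow> \<exists>u\<in>X. \<exists>k. rho u < s \<and> d ((f ^^ (k * L)) u) y < s"
        using exit_point[OF _ r(1) L] by blast
      then show ?thesis by blast
    qed
    \<comment> \<open>\<open>exit_point\<close> yields a point for one \<open>L\<close> only.
      Factorials are used because each \<open>L\<close> divides \<open>fact n\<close> once
      \<open>n \<ge> L\<close>, so a cluster point of the \<open>y n\<close> works for every
      \<open>L\<close>.\<close>
    then have "\<forall>n. \<exists>y. y \<in> X \<and> rho y = r \<and>
        (\<forall>s>0. \<exists>u\<in>X. \<exists>k. rho u < s \<and> d ((f ^^ (k * fact n)) u) y < s)"
      by simp
    then obtain y where y: "\<And>n. y n \<in> X" "\<And>n. rho (y n) = r"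
      "\<And>n s. s > 0 \<Longrightarrow> \<exists>u\<in>X. \<exists>k. rho u < s \<and> d ((f ^^ (k * fact n)) u) (y n) < s"
      by metis
    obtain z where z: "z \<in> X" "\<And>e N. e > 0 \<Longrightarrow> \<exists>n\<ge>N. d z (y n) < e"
      using cluster_point[of y] y by auto
    have "rho z = r"
    proof (rule antisym; rule field_le_epsilon)
      fix e :: real assume "e > 0"
      then obtain n where n: "d z (y n) < e" using z by blast
      show "rho z \<le> r + e" using rho_triangle[OF z(1) y(1)[of n]] y(2)[of n] n by linarith
      show "r \<le> rho z + e" using rho_triangle[OF y(1)[of n] z(1)] y(2)[of n] n commute[of z "y n"] by linarith
    qed
    moreover have "z \<in> K"
      unfolding K_def
    proof (intro CollectI conjI allI impI)
      fix L :: nat and s :: real assume L: "1 \<le> L" "0 < s"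
      obtain n where n: "n \<ge> L" "d z (y n) < s / 2" using z(2)[of "s / 2"] L by auto
      obtain u k where u: "u \<in> X" "rho u < s / 2" "d ((f ^^ (k * fact n)) u) (y n) < s / 2"
        using y(3)[of "s / 2" n] L by auto
      obtain q :: nat where "fact n = q * L"
        using dvd_fact[of L n] L n by (metis dvd_def mult.commute)
      moreover have "d ((f ^^ (k * fact n)) u) z \<le> d ((f ^^ (k * fact n)) u) (y n) + d (y n) z"
        using u y z by (intro triangle) auto
      ultimately show "\<exists>u\<in>X. \<exists>k. rho u < s \<and> d ((f ^^ (k * L)) u) z < s"
        using u n L commute[of z "y n"] by (intro bexI[of _ u] exI[of _ "k * q"]) (auto simp: mult.assoc)
    qed (rule z)
    ultimately show ?thesis by blast
  qed
  then have "{0<..<e} \<subseteq> rho ` K" by auto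
  moreover have "uncountable {0<..<e}" using \<open>e > 0\<close> by (simp add: uncountable_open_interval)
  ultimately show ?thesis using countable_image countable_subset by blast
qed

text \<open>
  Adding the target $z$ to $E$ only changes the time $l$ by a multiple of a common period of all
  points chosen so far. The new point is found close to $C$ because $z$ is the image under $f^l$
  of another point of $K$.
\<close>
lemma steering_step:
  assumes "finite Q" "Q \<subseteq> X" "finite E" "E \<subseteq> K" "e > 0"
  shows "\<exists>G l. finite G \<and> G \<subseteq> X \<and> T \<le> l \<and> (\<forall>u\<in>G. \<forall>j\<le>T. rho ((f ^^ j) u) < e) \<and>
    (\<forall>a\<in>Q. (f ^^ l) a = a) \<and>
    (\<forall>u\<in>G. \<exists>z\<in>E. d ((f ^^ l) u) z < e) \<and> (\<forall>z\<in>E. \<exists>u\<in>G. d ((f ^^ l) u) z < e)"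
  using assms(3,4)
proof (induction E)
  case empty
  obtain L where L: "L \<ge> 1" "\<And>a. a \<in> Q \<Longrightarrow> (f ^^ L) a = a" using common_period assms by metis
  then have "(f ^^ (T * L)) a = a" if "a \<in> Q" for a using funpow_mult_fixed that by metis
  then show ?case using L by (intro exI[of _ "{}"] exI[of _ "T * L"]) auto
next
  case (insert z E)
  then obtain G l where G: "finite G" "G \<subseteq> X" "T \<le> l" "\<forall>u\<in>G. \<forall>j\<le>T. rho ((f ^^ j) u) < e"
    "\<forall>a\<in>Q. (f ^^ l) a = a" "\<forall>u\<in>G. \<exists>z\<in>E. d ((f ^^ l) u) z < e"
    "\<forall>z\<in>E. \<exists>u\<in>G. d ((f ^^ l) u) z < e"
    by auto
  \<comment> \<open>Including \<open>G\<close> here preserves the targets already reached: on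
    \<open>Q\<close> and \<open>G\<close>, adding a multiple of \<open>L\<close> to \<open>l\<close>
    changes nothing.\<close>
  obtain L where L: "L \<ge> 1" "\<And>a. a \<in> Q \<union> G \<Longrightarrow> (f ^^ L) a = a"
    using common_period[of "Q \<union> G"] assms G by auto
  have z: "z \<in> K" "z \<in> X" using insert K_sub by auto
  obtain p where p: "p \<ge> 1" "(f ^^ p) z = z" using period z by blast
  \<comment> \<open>The preimage of \<open>z\<close> under \<open>f ^^ l\<close>, written as a
    forward iterate by means of the period \<open>p\<close>, so that \<open>K_pow\<close> applies to
    it.\<close>
  define z' where "z' = (f ^^ (l * p - l)) z"
  have z': "z' \<in> K" "z' \<in> X" using K_pow z by (auto simp: z'_def)
  have "l \<le> l * p" using p by simp
  then have "(f ^^ l) z' = (f ^^ (l * p)) z"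
    unfolding z'_def by (metis comp_apply funpow_add le_add_diff_inverse)
  then have fz': "(f ^^ l) z' = z" using funpow_mult_fixed p by metis
  obtain s where s: "s > 0" "\<And>y. y \<in> X \<Longrightarrow> d z' y < s \<Longrightarrow> d ((f ^^ l) z') ((f ^^ l) y) < e"
    using pow_cont[OF z'(2) \<open>e > 0\<close>] by metis
  obtain t where t: "t > 0" "\<And>u j. u \<in> X \<Longrightarrow> rho u < t \<Longrightarrow> j \<le> T \<Longrightarrow> rho ((f ^^ j) u) < e"
    using rho_pow_small[OF \<open>e > 0\<close>] by metis
  obtain u k where u: "u \<in> X" "rho u < min s t" "d ((f ^^ (k * L)) u) z' < min s t"
    using KD[OF z'(1) L(1), of "min s t"] s t by auto
  have shift: "(f ^^ (l + k * L)) a = (f ^^ l) a" if "a \<in> Q \<union> G" for a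
    using funpow_mult_fixed[OF L(2)[OF that]] by (simp add: funpow_add)
  have "d z ((f ^^ (l + k * L)) u) < e"
    using s(2)[of "(f ^^ (k * L)) u"] u commute fz' by (simp add: funpow_add)
  then have du: "d ((f ^^ (l + k * L)) u) z < e" using commute by simp
  show ?case
    by (rule exI[of _ "insert u G"], rule exI[of _ "l + k * L"])
      (use G u du t shift in auto)
qed

text \<open>Iterates \<open>steering_step\<close>, with \<open>Q\<close> the union of the earlier
  batches and \<open>T\<close> one more than the last steering time. Then each batch is fixed at all
  later steering times, and is still close to \<open>C\<close> at all earlier ones.\<close>

lemma steering_sequence:
  assumes "\<And>m. finite (E m)" "\<And>m. E m \<subseteq> K"
  obtains G l where "\<And>m. finite (G m)" "\<And>m. G m \<subseteq> X" "\<And>m::nat. m \<le> l m"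
    "\<And>i m a. i < m \<Longrightarrow> a \<in> G i \<Longrightarrow> (f ^^ l m) a = a"
    "\<And>m u. u \<in> G m \<Longrightarrow> \<exists>z\<in>E m. d ((f ^^ l m) u) z < 1 / Suc m"
    "\<And>m z. z \<in> E m \<Longrightarrow> \<exists>u\<in>G m. d ((f ^^ l m) u) z < 1 / Suc m"
    "\<And>i m u. m < i \<Longrightarrow> u \<in> G i \<Longrightarrow> rho ((f ^^ l m) u) < 1 / Suc i"
    "\<And>m u. u \<in> G m \<Longrightarrow> rho u < 1 / Suc m"
proof -
  define step where "step n Q T G l \<longleftrightarrow> finite G \<and> G \<subseteq> X \<and> T \<le> l \<and>
    (\<forall>u\<in>G. \<forall>j\<le>T. rho ((f ^^ j) u) < 1 / Suc n) \<and> (\<forall>a\<in>Q. (f ^^ l) a = a) \<and>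
    (\<forall>u\<in>G. \<exists>z\<in>E n. d ((f ^^ l) u) z < 1 / Suc n) \<and>
    (\<forall>z\<in>E n. \<exists>u\<in>G. d ((f ^^ l) u) z < 1 / Suc n)" for n Q T G l
  define inv where "inv n s \<longleftrightarrow> (case s of (Q, T, G, l) \<Rightarrow> finite Q \<and> Q \<subseteq> X \<and> n \<le> T \<and> step n Q T G l)"
    for n s
  define succ where "succ s s' \<longleftrightarrow> (case (s, s') of ((Q, T, G, l), (Q', T', G', l')) \<Rightarrow> Q' = Q \<union> G \<and> T' = Suc l)"
    for s s' :: "'a set \<times> nat \<times> 'a set \<times> nat"
  have ex: "\<exists>G l. step n Q T G l" if "finite Q" "Q \<subseteq> X" for n Q T
    unfolding step_def using steering_step[OF that assms] by auto
  have "\<exists>s. \<forall>n. inv n (s n) \<and> succ (s n) (s (Suc n))"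
  proof (rule dependent_nat_choice)
    obtain G l where "step 0 {} 0 G l" using ex[of "{}" 0 0] by auto
    then show "\<exists>s. inv 0 s" by (intro exI[of _ "({}, 0, G, l)"]) (auto simp: inv_def)
  next
    fix s n assume s: "inv n s"
    obtain Q T G l where sd: "s = (Q, T, G, l)" by (cases s)
    have Q: "finite (Q \<union> G)" "Q \<union> G \<subseteq> X" "Suc n \<le> Suc l"
      using s by (auto simp: inv_def step_def sd)
    obtain G' l' where "step (Suc n) (Q \<union> G) (Suc l) G' l'" using ex[OF Q(1,2)] by blast
    then show "\<exists>s'. inv (Suc n) s' \<and> succ s s'"
      using Q by (intro exI[of _ "(Q \<union> G, Suc l, G', l')"]) (auto simp: inv_def succ_def sd)
  qed
  then obtain s where s: "\<And>n. inv n (s n)" "\<And>n. succ (s n) (s (Suc n))" by blast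
  define Q where "Q n = fst (s n)" for n
  define T where "T n = fst (snd (s n))" for n
  define G where "G n = fst (snd (snd (s n)))" for n
  define l where "l n = snd (snd (snd (s n)))" for n
  have st: "step n (Q n) (T n) (G n) (l n)" "n \<le> T n" for n
    using s(1)[of n] by (auto simp: inv_def Q_def T_def G_def l_def split: prod.splits)
  have sc: "Q (Suc n) = Q n \<union> G n" "T (Suc n) = Suc (l n)" for n
    using s(2)[of n] by (auto simp: succ_def Q_def T_def G_def l_def split: prod.splits)
  have GQ: "G i \<subseteq> Q m" if "i < m" for i m
    using that by (induction m) (auto simp: sc less_Suc_eq)
  have lT: "l i \<le> T m" if "i < m" for i m
    using that
  proof (induction m)
    case (Suc m)
    have "T m \<le> l m" using st(1)[of m] by (simp add: step_def)
    then show ?case using Suc by (cases "i = m") (auto simp: sc)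
  qed simp
  show ?thesis
  proof (rule that[of G l])
    fix m show "finite (G m)" "G m \<subseteq> X" "m \<le> l m" using st[of m] by (auto simp: step_def)
  next
    fix i m a assume "i < m" "a \<in> G i"
    then have "a \<in> Q m" using GQ by blast
    then show "(f ^^ l m) a = a" using st(1)[of m] by (simp add: step_def)
  next
    fix i m u assume "m < i" "u \<in> G i"
    then have "l m \<le> T i" using lT by blast
    then show "rho ((f ^^ l m) u) < 1 / Suc i"
      using st(1)[of i] \<open>u \<in> G i\<close> unfolding step_def by blast
  next
    fix m u assume "u \<in> G m"
    then have "rho ((f ^^ 0) u) < 1 / Suc m" using st(1)[of m] unfolding step_def by blast
    then show "rho u < 1 / Suc m" by simp
  qed (use st in \<open>auto simp: step_def\<close>)
qed

text \<open>\<open>P\<close> is the union of the batches \<open>G m\<close>. One set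
  \<open>P\<close> serves every \<open>S\<close>, because finite subsets of finer and finer nets of
  \<open>K\<close> approximate all subsets of \<open>K\<close> and form a countable family, which
  can be used up as targets.\<close>

lemma steering_set:
  obtains P where "countable P" "P \<subseteq> X" "\<And>e. e > 0 \<Longrightarrow> finite {x \<in> P. e \<le> rho x}"
    "\<And>S e N. S \<subseteq> K \<Longrightarrow> e > 0 \<Longrightarrow> \<exists>l\<ge>N.
      (\<forall>a\<in>P. \<exists>b\<in>P \<union> C \<union> S. d ((f ^^ l) a) b < e) \<and> (\<forall>b\<in>P \<union> S. \<exists>a\<in>P \<union> C. d ((f ^^ l) a) b < e)"
proof -
  have "\<forall>n. \<exists>A. finite A \<and> A \<subseteq> K \<and> (\<forall>y\<in>K. \<exists>z\<in>A. d z y < 1 / real (Suc n))"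
  proof
    fix n
    obtain A where "finite A" "A \<subseteq> K" "\<And>y. y \<in> K \<Longrightarrow> \<exists>z\<in>A. d z y < 1 / real (Suc n)"
      using finite_net[OF K_sub, of "1 / real (Suc n)"] by auto
    then show "\<exists>A. finite A \<and> A \<subseteq> K \<and> (\<forall>y\<in>K. \<exists>z\<in>A. d z y < 1 / real (Suc n))" by blast
  qed
  then obtain A where A: "\<And>n. finite (A n)" "\<And>n. A n \<subseteq> K"
    "\<And>n y. y \<in> K \<Longrightarrow> \<exists>z\<in>A n. d z y < 1 / real (Suc n)" by metis
  define F where "F = (\<Union>n. Pow (A n))"
  have "countable (Pow (A n))" for n using A(1) by (simp add: countable_finite)
  then have F: "countable F" "F \<noteq> {}" unfolding F_def by auto
  \<comment> \<open>Decoding a pair lists every member of \<open>F\<close> at arbitrarily large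
    indices \<open>m\<close>, hence at arbitrarily late times.\<close>
  define E where "E m = from_nat_into F (fst (prod_decode m))" for m
  have EF: "E m \<in> F" for m unfolding E_def by (rule from_nat_into[OF F(2)])
  have E: "finite (E m)" "E m \<subseteq> K" for m
  proof -
    obtain n where "E m \<subseteq> A n" using EF[of m] unfolding F_def by auto
    then show "finite (E m)" "E m \<subseteq> K" using A(1,2)[of n] finite_subset by auto
  qed
  obtain G l where G: "\<And>m. finite (G m)" "\<And>m. G m \<subseteq> X" "\<And>m::nat. m \<le> l m"
    and old: "\<And>i m a. i < m \<Longrightarrow> a \<in> G i \<Longrightarrow> (f ^^ l m) a = a"
    and to: "\<And>m u. u \<in> G m \<Longrightarrow> \<exists>z\<in>E m. d ((f ^^ l m) u) z < 1 / Suc m"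
    and onto: "\<And>m z. z \<in> E m \<Longrightarrow> \<exists>u\<in>G m. d ((f ^^ l m) u) z < 1 / Suc m"
    and new: "\<And>i m u. m < i \<Longrightarrow> u \<in> G i \<Longrightarrow> rho ((f ^^ l m) u) < 1 / Suc i"
    and init: "\<And>m u. u \<in> G m \<Longrightarrow> rho u < 1 / Suc m"
    by (rule steering_sequence[of E, OF E]) (rule that)
  have inv_le: "1 / real (Suc j) \<le> 1 / real (Suc i)" if "i \<le> j" for i j
    using that by (intro divide_left_mono) auto
  show ?thesis
  proof (rule that[of "\<Union>m. G m"])
    show "countable (\<Union>m. G m)" using G by (auto intro: countable_finite)
    show "(\<Union>m. G m) \<subseteq> X" using G by auto
  next
    fix e :: real assume "e > 0"
    then obtain M where M: "1 / real (Suc M) < e" by (rule nat_approx_posE)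
    have "m < M" if "u \<in> G m" "e \<le> rho u" for u m
      using init[OF that(1)] that(2) M inv_le[of M m] by (cases "m < M") auto
    then have "{x \<in> \<Union>m. G m. e \<le> rho x} \<subseteq> (\<Union>m<M. G m)" by auto
    then show "finite {x \<in> \<Union>m. G m. e \<le> rho x}"
      by (rule finite_subset) (use G(1) in auto)
  next
    fix S :: "'a set" and e :: real and N :: nat
    assume S: "S \<subseteq> K" and e: "e > 0"
    obtain n where n: "1 / real (Suc n) < e / 2" using e nat_approx_posE[of "e / 2"] by auto
    \<comment> \<open>The net points close to \<open>S\<close>: a finite approximation of
      \<open>S\<close> in both directions, and a member of \<open>F\<close>.\<close>
    define S' where "S' = {z \<in> A n. \<exists>s\<in>S. d z s < 1 / real (Suc n)}"
    have "S' \<in> F" unfolding F_def S'_def by auto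
    then obtain i where i: "from_nat_into F i = S'" using from_nat_into_surj[OF F(1)] by blast
    define m where "m = prod_encode (i, max N n)"
    have m: "m \<ge> N" "m \<ge> n" using le_prod_encode_2[of "max N n" i] by (auto simp: m_def)
    have Em: "E m = S'" unfolding E_def m_def using i by simp
    have sm: "1 / real (Suc j) < e / 2" if "j \<ge> m" for j
      using inv_le[of n j] that m(2) n by linarith
    have near: "d a b < e" if "d a z < e / 2" "d z b < e / 2" "a \<in> X" "z \<in> X" "b \<in> X" for a b z
      using triangle[of a z b] that by linarith
    have AX: "A n \<subseteq> X" "S \<subseteq> X" using A(2)[of n] S K_sub by blast+
    have GX: "a \<in> X" if "a \<in> G j" for a j using G(2) that by blast
    \<comment> \<open>Batches before \<open>m\<close> are fixed by \<open>f ^^ l m\<close>, batch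
      \<open>m\<close> lands near \<open>S'\<close>, and later batches are still near
      \<open>C\<close>.\<close>
    have "\<exists>b\<in>(\<Union>m. G m) \<union> C \<union> S. d ((f ^^ l m) a) b < e" if a: "a \<in> G j" for a j
    proof (cases j m rule: linorder_cases)
      case less
      then show ?thesis using old[OF less a] a GX[OF a] e by (intro bexI[of _ a]) auto
    next
      case equal
      obtain z where z: "z \<in> S'" "d ((f ^^ l m) a) z < 1 / Suc m" using to a equal Em by blast
      then obtain s where s: "s \<in> S" "d z s < 1 / Suc n" by (auto simp: S'_def)
      have "d ((f ^^ l m) a) s < e"
        using z s n sm[of m] AX GX[OF a] by (intro near[of _ z]) (auto simp: S'_def)
      then show ?thesis using s by blast
    next
      case greater
      then have "rho ((f ^^ l m) a) < e" using new[OF greater a] sm[of j] e by simp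
      then show ?thesis using rho_less_iff by blast
    qed
    moreover have "\<exists>a\<in>(\<Union>m. G m) \<union> C. d ((f ^^ l m) a) b < e" if b: "b \<in> (\<Union>m. G m) \<union> S" for b
    proof -
      consider j where "b \<in> G j" "j < m" | j where "b \<in> G j" "j \<ge> m" | "b \<in> S"
        using b by (metis UN_iff Un_iff not_le)
      then show ?thesis
      proof cases
        case 1
        then show ?thesis using old GX e by (intro bexI[of _ b]) auto
      next
        \<comment> \<open>Points of the batches from \<open>m\<close> on lie close to
          \<open>C\<close>, and \<open>C\<close> is mapped onto itself, so images of
          \<open>C\<close> approximate them.\<close>
        case 2
        then have "rho b < e" using init[of b j] sm[of j] e by simp
        then obtain c where c: "c \<in> C" "d b c < e" using rho_less_iff by blast
        obtain a where "a \<in> C" "(f ^^ l m) a = c" using C_pow_image c(1) by (metis imageE)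
        then show ?thesis using c commute by (intro bexI[of _ a]) auto
      next
        case 3
        then obtain z where z: "z \<in> A n" "d z b < 1 / Suc n" using A(3) S by blast
        then have "z \<in> S'" using 3 unfolding S'_def by auto
        then obtain u where u: "u \<in> G m" "d ((f ^^ l m) u) z < 1 / Suc m" using onto Em by blast
        have "d ((f ^^ l m) u) b < e"
          using z u n sm[of m] AX GX[OF u(1)] 3 by (intro near[of _ z]) auto
        then show ?thesis using u by blast
      qed
    qed
    ultimately show "\<exists>l\<ge>N. (\<forall>a\<in>\<Union>m. G m. \<exists>b\<in>(\<Union>m. G m) \<union> C \<union> S. d ((f ^^ l) a) b < e) \<and>
        (\<forall>b\<in>(\<Union>m. G m) \<union> S. \<exists>a\<in>(\<Union>m. G m) \<union> C. d ((f ^^ l) a) b < e)"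
      using G(3)[of m] m by (intro exI[of _ "l m"]) auto
  qed
qed

subsection \<open>A chaotic family of closed sets\<close>

lemma K_closed: "closedin mtopology K"
proof -
  have "mtopology closure_of K \<subseteq> K"
  proof
    fix z assume "z \<in> mtopology closure_of K"
    then have z: "z \<in> X" "\<And>r. r > 0 \<Longrightarrow> \<exists>y\<in>K. y \<in> mball z r"
      by (auto simp: metric_closure_of)
    show "z \<in> K"
    proof (rule K_limit[OF z(1)])
      fix e :: real assume "e > 0"
      then show "\<exists>w\<in>K. d w z < e" using z(2)[of e] commute by auto
    qed
  qed
  then show ?thesis
    using closure_of_subset_eq[of K mtopology] K_sub by simp
qed

text \<open>Off \<open>C\<close> the set \<open>P\<close> is locally finite: points of
  \<open>P\<close> within \<open>rho x / 2\<close> of \<open>x\<close> have distance at least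
  \<open>rho x / 2\<close> from \<open>C\<close>, so there are finitely many.\<close>

lemma accumulating_at_C_closed:
  assumes P: "P \<subseteq> X" "\<And>e. e > 0 \<Longrightarrow> finite {x \<in> P. e \<le> rho x}" and S: "closedin mtopology S"
  shows "P \<union> C \<union> S \<in> H"
proof -
  have fin_closed: "closedin mtopology F" if "finite F" "F \<subseteq> X" for F
    using closedin_Hausdorff_finite[OF Hausdorff_space_mtopology] that by simp
  have "\<exists>r>0. disjnt (P \<union> C \<union> S) (mball x r)" if x: "x \<in> X" "x \<notin> P \<union> C \<union> S" for x
  proof -
    have pos: "rho x > 0" using rho_eq_0[OF x(1)] rho_nonneg[of x] x(2) by fastforce
    let ?F = "{p \<in> P. rho x / 2 \<le> rho p}"
    have "finite ?F" by (rule P(2)) (use pos in simp)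
    then have "closedin mtopology ?F" using P(1) by (intro fin_closed) auto
    then have "closedin mtopology (?F \<union> C \<union> S)"
      using fin_closed[OF C_fin C_sub] S by (intro closedin_Un)
    then obtain s where s: "s > 0" "disjnt (?F \<union> C \<union> S) (mball x s)"
      using x unfolding closedin_metric by auto
    have "p \<in> ?F" if "p \<in> P" "d x p < rho x / 2" for p
      using rho_triangle[OF x(1), of p] that P(1) by auto
    then have "disjnt (P \<union> C \<union> S) (mball x (min s (rho x / 2)))"
      using s(2) unfolding disjnt_iff by auto
    then show ?thesis using s(1) pos by (intro exI[of _ "min s (rho x / 2)"]) auto
  qed
  moreover have "P \<union> C \<union> S \<subseteq> X" using P C_sub closedin_subset[OF S] by auto
  ultimately show ?thesis using C_ne unfolding hyperspace_def closedin_metric by auto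
qed

lemma chaotic_family:
  assumes K_unc: "uncountable K"
  obtains F where "uncountable F" "F \<subseteq> recurrent_points H dH (image f)"
    "F \<inter> almost_periodic_points H dH (image f) = {}"
    "scrambled_set H dH (image f) F" "omega_scrambled_set H dH (image f) F"
proof -
  obtain P where P: "countable P" "P \<subseteq> X" "\<And>e. e > 0 \<Longrightarrow> finite {x \<in> P. e \<le> rho x}"
    and steer: "\<And>S e N. S \<subseteq> K \<Longrightarrow> e > 0 \<Longrightarrow> \<exists>l\<ge>N.
      (\<forall>a\<in>P. \<exists>b\<in>P \<union> C \<union> S. d ((f ^^ l) a) b < e) \<and> (\<forall>b\<in>P \<union> S. \<exists>a\<in>P \<union> C. d ((f ^^ l) a) b < e)"
    by (rule steering_set) (rule that)
  define B where "B S = P \<union> C \<union> S" for S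
  define A where "A q = B (orbit q)" for q
  define \<Omega> where "\<Omega> = omega_limit H dH (image f)"
  have orbK: "orbit q \<subseteq> K" if "q \<in> K" for q
    using K_pow[OF that] by (auto simp: orbit_def)
  have orb_closed: "closedin mtopology (orbit q)" if "q \<in> K" for q
    using closedin_Hausdorff_finite[OF Hausdorff_space_mtopology, of "orbit q"]
      orbit_finite[of q] orbit_subset[of q] that K_sub by auto
  have BH: "B S \<in> H" if "closedin mtopology S" for S
    unfolding B_def using accumulating_at_C_closed[OF P(2,3) that] .
  have AH: "A q \<in> H" if "q \<in> K" for q
    unfolding A_def using BH orb_closed that by blast
  \<comment> \<open>One time \<open>l\<close> works for all \<open>q\<close> at once, since
    \<open>P\<close> is common to all \<open>A q\<close> while \<open>C\<close> and
    \<open>orbit q\<close> are invariant. Proximality depends on this.\<close>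
  have conv: "\<exists>l\<ge>N. \<forall>q\<in>K. dH ((f ^^ l) ` A q) (B (S \<union> orbit q)) < e"
    if S: "S \<subseteq> K" "closedin mtopology S" and e: "e > 0" for S e N
  proof -
    obtain l where l: "l \<ge> N" "\<And>a. a \<in> P \<Longrightarrow> \<exists>b\<in>P \<union> C \<union> S. d ((f ^^ l) a) b < e / 2"
      "\<And>b. b \<in> P \<union> S \<Longrightarrow> \<exists>a\<in>P \<union> C. d ((f ^^ l) a) b < e / 2"
      using steer[OF S(1), of "e / 2" N] e by auto
    have "dH ((f ^^ l) ` A q) (B (S \<union> orbit q)) \<le> e / 2" if q: "q \<in> K" for q
    proof (rule hausdorff_le)
      show "(f ^^ l) ` A q \<in> H" using AH[OF q] by simp
      show "B (S \<union> orbit q) \<in> H" using BH closedin_Un[OF S(2) orb_closed[OF q]] by blast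
      have qX: "q \<in> X" using q K_sub by auto
      have self: "d b b \<le> e / 2" if "b \<in> C \<union> orbit q" for b
        using that C_sub orbit_subset[OF qX] e by auto
      show "\<exists>b\<in>B (S \<union> orbit q). d a b \<le> e / 2" if "a \<in> (f ^^ l) ` A q" for a
      proof -
        obtain x where x: "x \<in> P \<union> C \<union> orbit q" "a = (f ^^ l) x"
          using \<open>a \<in> (f ^^ l) ` A q\<close> by (auto simp: A_def B_def)
        show ?thesis
        proof (cases "x \<in> P")
          case True
          then show ?thesis using l(2) x(2) unfolding B_def by (meson UnCI UnE less_imp_le)
        next
          case False
          then have "a \<in> C \<union> orbit q" using x C_pow pow_orbit[OF qX] by blast
          then show ?thesis using self unfolding B_def by blast
        qed
      qed
      show "\<exists>a\<in>(f ^^ l) ` A q. d a b \<le> e / 2" if b: "b \<in> B (S \<union> orbit q)" for b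
      proof (cases "b \<in> P \<union> S")
        case True
        then obtain a where "a \<in> P \<union> C" "d ((f ^^ l) a) b < e / 2" using l(3) by blast
        then show ?thesis unfolding A_def B_def by (meson UnI1 image_eqI less_imp_le)
      next
        case False
        then have b': "b \<in> C \<union> orbit q" using b by (auto simp: B_def)
        then have "b \<in> (f ^^ l) ` A q"
          using C_pow_image[of l] pow_orbit[OF qX, of l] by (auto simp: A_def B_def)
        then show ?thesis using self[OF b'] by blast
      qed
    qed
    then show ?thesis using l(1) e by (intro exI[of _ l]) force
  qed
  have omega_iff: "D \<in> \<Omega> (A q) \<longleftrightarrow> D \<in> H \<and> (\<forall>e>0. \<forall>N. \<exists>k\<ge>N. dH ((f ^^ k) ` A q) D < e)"
    if "q \<in> K" for D q
    unfolding \<Omega>_def by (rule omega_limit_iff[OF AH[OF that]])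
  have in_omega: "B (S \<union> orbit q) \<in> \<Omega> (A q)"
    if "S \<subseteq> K" "closedin mtopology S" "q \<in> K" for S q
    unfolding omega_iff[OF that(3)]
    using conv[OF that(1,2)] BH closedin_Un[OF that(2) orb_closed[OF that(3)]] that(3) by blast
  have rec: "A q \<in> \<Omega> (A q)" if "q \<in> K" for q
    using in_omega[of "{}" q] that by (simp add: A_def)
  have B_K: "B (K \<union> orbit q) = B K" if "q \<in> K" for q
    using orbK[OF that] by (simp add: Un_absorb2)
  \<comment> \<open>All images of \<open>A q\<close> contain the invariant set
    \<open>orbit q\<close>, so \<open>q\<close> survives in the limit. This is the marker that tells
    limit sets apart.\<close>
  have orbit_in_omega: "q \<in> D" if q: "q \<in> K" and D: "D \<in> \<Omega> (A q)" for q D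
  proof (rule closedin_limit)
    show "closedin mtopology D" "q \<in> X" using D H_closed K_sub q omega_iff[OF q] by auto
    fix e :: real assume "e > 0"
    have DH: "D \<in> H" using D omega_iff[OF q] by blast
    obtain k where k: "dH ((f ^^ k) ` A q) D < e" using D omega_iff[OF q] \<open>e > 0\<close> by blast
    have "q \<in> (f ^^ k) ` orbit q" using self_in_orbit[of q] pow_orbit[of q k] q K_sub by blast
    then have "q \<in> (f ^^ k) ` A q" by (auto simp: A_def B_def)
    then obtain a where "a \<in> D" "d q a < e"
      using hausdorff_lessD[OF pow_image_H[OF AH[OF q]] DH k] by blast
    then show "\<exists>a\<in>D. d q a < e" by blast
  qed
  \<comment> \<open>With \<open>P\<close> and \<open>C\<close> removed, a point of \<open>Q\<close>
    can belong to \<open>A q\<close> only through \<open>orbit q\<close>.\<close>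
  define Q where "Q = K - (P \<union> C)"
  have PC: "countable (P \<union> C)" using P(1) C_fin by (simp add: countable_finite)
  have A_count: "countable (A q)" if "q \<in> K" for q
    using PC orbit_finite[of q] K_sub that unfolding A_def B_def by (auto simp: countable_finite)
  have Q_unc: "uncountable (Q - E)" if "countable E" for E
    using K_unc PC that unfolding Q_def by (simp add: uncountable_minus_countable)
  have QK: "q \<in> K" if "q \<in> Q" for q using that by (simp add: Q_def)
  have distinct: "q' \<notin> A q" if q: "q \<in> Q" "q' \<in> Q" "A q \<noteq> A q'" for q q'
  proof
    assume "q' \<in> A q"
    then have "q' \<in> orbit q" using q(2) by (auto simp: A_def B_def Q_def)
    then have "orbit q' = orbit q" using orbit_eq QK[OF q(1)] K_sub by blast
    then show False using q(3) by (simp add: A_def)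
  qed
  define F where "F = A ` Q"
  have F_unc: "uncountable F"
  proof
    assume "countable F"
    \<comment> \<open>\<open>A\<close> need not be injective, since points of one orbit give the
      same set. Its fibre over \<open>D\<close> is contained in the countable set
      \<open>D\<close>.\<close>
    moreover have "countable {q' \<in> Q. A q' = D}" if "D \<in> F" for D
    proof -
      obtain q where q: "q \<in> Q" "D = A q" using \<open>D \<in> F\<close> by (auto simp: F_def)
      have "q' \<in> D" if "q' \<in> Q" "A q' = D" for q'
        using that self_in_orbit[of q'] by (auto simp: A_def B_def)
      then have "{q' \<in> Q. A q' = D} \<subseteq> D" by blast
      then show ?thesis by (rule countable_subset) (simp add: q(2) A_count[OF QK[OF q(1)]])
    qed
    ultimately have cnt: "countable (\<Union>D\<in>F. {q' \<in> Q. A q' = D})" by (rule countable_UN)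
    have "Q - {} \<subseteq> (\<Union>D\<in>F. {q' \<in> Q. A q' = D})" by (auto simp: F_def)
    then have "countable (Q - {})" using cnt by (rule countable_subset)
    then show False using Q_unc[of "{}"] by simp
  qed
  have FH: "F \<subseteq> H" using AH QK by (auto simp: F_def)
  \<comment> \<open>\<open>B K\<close> absorbs every \<open>orbit q\<close>, so at these times the
    images of all \<open>A q\<close> are close to one and the same set.\<close>
  have mask: "\<exists>l\<ge>N. \<forall>q\<in>K. dH ((f ^^ l) ` A q) (B K) < e" if "e > 0" for e N
    using conv[OF subset_refl K_closed that, of N] B_K by auto
  show ?thesis
  proof (rule that[OF F_unc])
    show "F \<subseteq> recurrent_points H dH (image f)"
      using FH rec QK by (auto simp: recurrent_points_def F_def \<Omega>_def)
  next
    have "A q \<notin> almost_periodic_points H dH (image f)" if q: "q \<in> Q" for q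
    proof
      assume ap: "A q \<in> almost_periodic_points H dH (image f)"
      have AqH: "A q \<in> H" using AH[OF QK[OF q]] .
      \<comment> \<open>\<open>A q\<close> is countable and closed, so some \<open>p\<close> in
        \<open>K\<close> has positive distance \<open>r\<close> from it. An image of
        \<open>A q\<close> close to \<open>B K\<close> comes near the whole orbit of
        \<open>p\<close>; hence for \<open>N\<close> more steps the images have a point near
        \<open>p\<close> and are not close to \<open>A q\<close>.\<close>
      have "Q - A q \<noteq> {}" using Q_unc[OF A_count[OF QK[OF q]]] by (metis countable_empty)
      then obtain p where p: "p \<in> K" "p \<notin> A q" using QK by blast
      have pX: "p \<in> X" using p K_sub by auto
      obtain r where r: "r > 0" "\<And>a. a \<in> A q \<Longrightarrow> r \<le> d p a"
        using closedin_limit[OF H_closed[OF AqH] pX] p(2) by (meson not_le)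
      have "openin hyper.mtopology (hyper.mball (A q) (r / 2))" "A q \<in> hyper.mball (A q) (r / 2)"
        using r(1) AqH by auto
      then obtain N where N: "\<And>n. {(image f ^^ (n + i)) (A q) |i. i \<in> {0..N}} \<inter> hyper.mball (A q) (r / 2) \<noteq> {}"
        using ap unfolding almost_periodic_points_def by blast
      obtain t where t: "t > 0"
        "\<And>z y j. z \<in> orbit p \<Longrightarrow> y \<in> X \<Longrightarrow> d z y < t \<Longrightarrow> j \<le> N \<Longrightarrow> d ((f ^^ j) z) ((f ^^ j) y) < r / 2"
        using pow_cont_finite[OF orbit_finite[OF pX] orbit_subset[OF pX], of "r / 2" N] r(1) by auto
      obtain l where l: "dH ((f ^^ l) ` A q) (B K) < t" using mask[OF t(1)] QK[OF q] by blast
      obtain i where i: "i \<in> {0..N}" "(image f ^^ (l + i)) (A q) \<in> hyper.mball (A q) (r / 2)"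
        using N[of l] by blast
      obtain z where z: "z \<in> orbit p" "(f ^^ i) z = p"
        using pow_orbit[OF pX, of i] self_in_orbit[of p] by (metis imageE)
      have "z \<in> B K" using z orbK[OF p(1)] by (auto simp: B_def)
      moreover have "dH (B K) ((f ^^ l) ` A q) < t" using l hyper.commute by metis
      ultimately obtain a where a: "a \<in> (f ^^ l) ` A q" "d z a < t"
        using hausdorff_lessD[OF BH[OF K_closed] pow_image_H[OF AqH]] by blast
      have aX: "a \<in> X" using a H_sub[OF pow_image_H[OF AqH]] by blast
      have pa: "d p ((f ^^ i) a) < r / 2" using t(2)[OF z(1) aX a(2), of i] i(1) z(2) by simp
      have "(f ^^ i) a \<in> (f ^^ (l + i)) ` A q"
        using a(1) pow_image_add[of i l "A q"] by (simp add: add.commute)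
      moreover have "dH ((f ^^ (l + i)) ` A q) (A q) < r / 2"
        using i(2) hyper.commute by (simp add: funpow_image)
      ultimately obtain b where b: "b \<in> A q" "d ((f ^^ i) a) b < r / 2"
        using hausdorff_lessD[OF pow_image_H[OF AqH] AqH] by blast
      have "d p b \<le> d p ((f ^^ i) a) + d ((f ^^ i) a) b"
        using pX aX b(1) H_sub[OF AqH] by (intro triangle) auto
      then show False using r(2)[OF b(1)] b(2) pa by linarith
    qed
    then show "F \<inter> almost_periodic_points H dH (image f) = {}" by (auto simp: F_def)
  next
    have "proximal dH (image f) (A q) (A q')" if "q \<in> Q" "q' \<in> Q" for q q'
      unfolding proximal_iff
    proof (intro allI impI)
      fix e :: real and N :: nat assume "e > 0"
      then obtain l where l: "l \<ge> N" "\<And>q. q \<in> K \<Longrightarrow> dH ((f ^^ l) ` A q) (B K) < e / 2"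
        using mask[of "e / 2" N] by auto
      have "dH ((f ^^ l) ` A q) ((f ^^ l) ` A q')
          \<le> dH ((f ^^ l) ` A q) (B K) + dH (B K) ((f ^^ l) ` A q')"
        using AH QK that BH[OF K_closed] by (intro hyper.triangle) auto
      then have "dH ((f ^^ l) ` A q) ((f ^^ l) ` A q') < e"
        using l(2)[OF QK[OF that(1)]] l(2)[OF QK[OF that(2)]] hyper.commute[of "B K"] by simp
      then show "\<exists>n\<ge>N. dH ((f ^^ n) ` A q) ((f ^^ n) ` A q') < e" using l(1) by blast
    qed
    moreover have "\<not> asymptotic dH (image f) (A q) (A q')" if q: "q \<in> Q" "q' \<in> Q" "A q \<noteq> A q'" for q q'
    proof
      assume "asymptotic dH (image f) (A q) (A q')"
      then have lim: "(\<lambda>n. dH ((f ^^ n) ` A q) ((f ^^ n) ` A q')) \<longlonglongrightarrow> 0"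
        by (simp add: asymptotic_iff)
      have AA: "A q \<in> H" "A q' \<in> H" using AH QK q by auto
      \<comment> \<open>With \<open>S = {}\<close> both sets return close to themselves at a common
        late time. The two return errors and the distance of the images are each below a third of
        the original distance.\<close>
      define e where "e = dH (A q) (A q') / 3"
      have e: "e > 0" unfolding e_def using hyper.mdist_pos_eq[OF AA] q(3) by simp
      obtain N where N: "\<And>n. n \<ge> N \<Longrightarrow> dH ((f ^^ n) ` A q) ((f ^^ n) ` A q') < e"
        using order_tendstoD(2)[OF lim e] by (auto simp: eventually_sequentially)
      obtain l where l: "l \<ge> N" "\<And>q. q \<in> K \<Longrightarrow> dH ((f ^^ l) ` A q) (A q) < e"
        using conv[of "{}" e N] e by (auto simp: A_def)
      let ?A = "(f ^^ l) ` A q" and ?A' = "(f ^^ l) ` A q'"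
      have "dH (A q) (A q') \<le> dH (A q) ?A + dH ?A (A q')" "dH ?A (A q') \<le> dH ?A ?A' + dH ?A' (A q')"
        using AA by (intro hyper.triangle; simp)+
      moreover have "dH (A q) ?A < e" "dH ?A' (A q') < e" "dH ?A ?A' < e"
        using l(2)[OF QK[OF q(1)]] l(2)[OF QK[OF q(2)]] N[OF l(1)] hyper.commute by metis+
      ultimately show False unfolding e_def by linarith
    qed
    ultimately show "scrambled_set H dH (image f) F"
      using FH unfolding scrambled_set_def Li_Yorke_pair_def F_def by blast
  next
    have unc: "uncountable (\<Omega> (A q) - \<Omega> (A q'))" if q: "q \<in> Q" "q' \<in> Q" "A q \<noteq> A q'" for q q'
    proof -
      \<comment> \<open>Leaving out \<open>A q\<close> makes \<open>?D\<close> injective, and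
        leaving out \<open>q'\<close> keeps the marker of \<open>A q'\<close> out of the limits
        \<open>?D y\<close>.\<close>
      let ?Y = "Q - (A q \<union> {q'})"
      let ?D = "\<lambda>y. B ({y} \<union> orbit q)"
      have D_eq: "?D y = insert y (A q)" for y by (auto simp: A_def B_def)
      have "uncountable ?Y" by (rule Q_unc) (simp add: A_count[OF QK[OF q(1)]])
      moreover have "inj_on ?D ?Y" unfolding D_eq by (rule inj_onI) blast
      ultimately have D_unc: "uncountable (?D ` ?Y)" by (blast dest: countable_image_inj_on)
      have "?D ` ?Y \<subseteq> \<Omega> (A q) - \<Omega> (A q')"
      proof
        fix D assume "D \<in> ?D ` ?Y"
        then obtain y where y: "y \<in> ?Y" "D = ?D y" by blast
        have "closedin mtopology {y}" "{y} \<subseteq> K"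
          using y QK K_sub closedin_Hausdorff_singleton[OF Hausdorff_space_mtopology, of y] by auto
        then have "D \<in> \<Omega> (A q)" using in_omega QK[OF q(1)] y(2) by blast
        moreover have "q' \<notin> D" using distinct[OF q] y D_eq by auto
        ultimately show "D \<in> \<Omega> (A q) - \<Omega> (A q')" using orbit_in_omega QK[OF q(2)] by blast
      qed
      then show ?thesis using D_unc countable_subset by metis
    qed
    have meet: "B K \<in> \<Omega> (A q)" if "q \<in> Q" for q
      using in_omega[OF subset_refl K_closed QK[OF that]] B_K[OF QK[OF that]] by simp
    have nonper: "\<not> pointwise_periodic (\<Omega> (A q)) (image f)" if q: "q \<in> Q" "uncountable (\<Omega> (A q))" for q
    proof
      assume "pointwise_periodic (\<Omega> (A q)) (image f)"
      \<comment> \<open>By recurrence \<open>A q\<close> belongs to its own limit set, so it would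
        be periodic itself.\<close>
      then obtain n where n: "n \<ge> 1" "(image f ^^ n) (A q) = A q"
        using rec[OF QK[OF q(1)]] by (auto simp: pointwise_periodic_def)
      have "(f ^^ n) ` A q = A q" using n(2) by (simp only: funpow_image)
      from countable_omega_limit_periodic[OF AH[OF QK[OF q(1)]] n(1) this]
      show False using q(2) by (simp add: \<Omega>_def)
    qed
    obtain D where D: "D \<in> F" using F_unc by (metis countable_empty ex_in_conv)
    have "uncountable (F - {D})" using F_unc by (simp add: uncountable_minus_countable)
    then have "F - {D} \<noteq> {}" by (metis countable_empty)
    then obtain D' where D': "D' \<in> F" "D \<noteq> D'" by blast
    have pairs: "\<forall>x\<in>F. \<forall>y\<in>F. x \<noteq> y \<longrightarrow> uncountable (\<Omega> x - \<Omega> y) \<and>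
      \<Omega> x \<inter> \<Omega> y \<noteq> {} \<and> \<not> pointwise_periodic (\<Omega> x) (image f)"
    proof (intro ballI impI)
      fix x y assume xy: "x \<in> F" "y \<in> F" "x \<noteq> y"
      obtain q q' where q: "q \<in> Q" "q' \<in> Q" "x = A q" "y = A q'" using xy by (auto simp: F_def)
      have u: "uncountable (\<Omega> x - \<Omega> y)" using unc q xy by blast
      then have "uncountable (\<Omega> x)" using countable_subset[of "\<Omega> x - \<Omega> y" "\<Omega> x"] by auto
      then have "\<not> pointwise_periodic (\<Omega> x) (image f)" using nonper[OF q(1)] q(3) by simp
      moreover have "B K \<in> \<Omega> x \<inter> \<Omega> y" using meet q by simp
      ultimately show "uncountable (\<Omega> x - \<Omega> y) \<and>
          \<Omega> x \<inter> \<Omega> y \<noteq> {} \<and> \<not> pointwise_periodic (\<Omega> x) (image f)"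
        using u by blast
    qed
    have "\<exists>x\<in>F. \<exists>y\<in>F. x \<noteq> y" using D D' by blast
    with FH pairs show "omega_scrambled_set H dH (image f) F"
      unfolding omega_scrambled_set_def \<Omega>_def by (intro conjI)
  qed
qed

end

section \<open>Failure of equicontinuity in the space and in its hyperspace\<close>

context periodic_homeo
begin

text \<open>\<open>C\<close> is the orbit of a point where equicontinuity fails. By
  \<open>stable_imp_equicontinuous_at\<close> this cycle is unstable, which makes \<open>K\<close>
  uncountable.\<close>

lemma not_equicontinuous_imp_chaotic_family:
  assumes "\<not> equicontinuous_system X d f"
  obtains F where "uncountable F" "F \<subseteq> recurrent_points H dH (image f)"
    "F \<inter> almost_periodic_points H dH (image f) = {}"
    "scrambled_set H dH (image f) F" "omega_scrambled_set H dH (image f) F"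
proof -
  obtain x e where x: "x \<in> X" and e: "e > 0"
    and bad: "\<not> (\<exists>r>0. \<forall>n. \<forall>y\<in>X. d x y < r \<longrightarrow> d ((f ^^ n) x) ((f ^^ n) y) < e)"
    using assms unfolding equicontinuous_system_def by blast
  interpret periodic_homeo_core X d f h "orbit x"
    using orbit_finite[OF x] self_in_orbit[of x] orbit_subset[OF x] f_orbit[OF x]
    by unfold_locales auto
  obtain e0 where e0: "e0 > 0" "\<not> (\<exists>r>0. \<forall>u\<in>X. rho u < r \<longrightarrow> (\<forall>k. rho ((f ^^ k) u) < e0))"
    using stable_imp_equicontinuous_at[OF _ self_in_orbit e] bad by blast
  have unstable: "\<exists>u\<in>X. \<exists>k. rho u < r \<and> e0 \<le> rho ((f ^^ k) u)" if "r > 0" for r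
    using e0(2) that by (meson not_le)
  obtain e1 where "e1 > 0"
    "\<And>L r. L \<ge> 1 \<Longrightarrow> r > 0 \<Longrightarrow> \<exists>u\<in>X. \<exists>k. rho u < r \<and> e1 \<le> rho ((f ^^ (k * L)) u)"
    by (rule unstable_uniform[OF e0(1) unstable]) (assumption, rule that)
  then have "uncountable K" by (rule K_uncountable)
  then show ?thesis by (rule chaotic_family) (rule that)
qed

lemma singleton_H: "x \<in> X \<Longrightarrow> {x} \<in> H"
  using closedin_Hausdorff_singleton[OF Hausdorff_space_mtopology, of x] by (simp add: hyperspace_def)

lemma hausdorff_singletons: "x \<in> X \<Longrightarrow> y \<in> X \<Longrightarrow> dH {x} {y} = d x y"
  by (simp add: hausdorff_dist_def singleton_H)

text \<open>Singletons embed \<open>X\<close> isometrically into \<open>H\<close>, compatibly with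
  the two maps.\<close>

lemma equicontinuous_hyperspace_imp:
  assumes "equicontinuous_system H dH (image f)"
  shows "equicontinuous_system X d f"
  unfolding equicontinuous_system_def
proof (intro ballI allI impI)
  fix x and e :: real assume x: "x \<in> X" and e: "e > 0"
  have "\<exists>r>0. \<forall>n. \<forall>A\<in>H. dH {x} A < r \<longrightarrow> dH ((image f ^^ n) {x}) ((image f ^^ n) A) < e"
    using assms singleton_H[OF x] e by (simp add: equicontinuous_system_def)
  then obtain r where r: "r > 0"
    "\<And>n A. A \<in> H \<Longrightarrow> dH {x} A < r \<Longrightarrow> dH ((image f ^^ n) {x}) ((image f ^^ n) A) < e"
    by blast
  have "d ((f ^^ n) x) ((f ^^ n) y) < e" if y: "y \<in> X" "d x y < r" for n y
    using r(2)[OF singleton_H[OF y(1)], of n] x y by (simp add: funpow_image hausdorff_singletons)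
  then show "\<exists>r>0. \<forall>n. \<forall>y\<in>X. d x y < r \<longrightarrow> d ((f ^^ n) x) ((f ^^ n) y) < e"
    using r(1) by blast
qed

end

subsection \<open>Equicontinuous systems\<close>

locale equicontinuous_periodic_homeo = periodic_homeo +
  assumes equicontinuous: "equicontinuous_system X d f"
begin

text \<open>\<open>equicontinuous_system\<close> lets the radius depend on the point. Compactness
  removes this: pairs violating every uniform radius would cluster at a point \<open>z\<close>, and
  both members would follow the orbit of \<open>z\<close>.\<close>

lemma uniform:
  assumes e: "e > 0"
  obtains r where "r > 0"
    "\<And>x y n. x \<in> X \<Longrightarrow> y \<in> X \<Longrightarrow> d x y < r \<Longrightarrow> d ((f ^^ n) x) ((f ^^ n) y) < e"
proof (rule ccontr)
  assume no: "\<not> thesis"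
  have "\<forall>m. \<exists>x y n. x \<in> X \<and> y \<in> X \<and> d x y < 1 / real (Suc m) \<and> e \<le> d ((f ^^ n) x) ((f ^^ n) y)"
  proof
    fix m
    have "0 < 1 / real (Suc m)" by simp
    with no that show "\<exists>x y n. x \<in> X \<and> y \<in> X \<and> d x y < 1 / real (Suc m) \<and> e \<le> d ((f ^^ n) x) ((f ^^ n) y)"
      by (meson not_le)
  qed
  then obtain x y n where xy: "\<And>m. x m \<in> X" "\<And>m. y m \<in> X" "\<And>m. d (x m) (y m) < 1 / real (Suc m)"
    "\<And>m. e \<le> d ((f ^^ n m) (x m)) ((f ^^ n m) (y m))" by metis
  obtain z where z: "z \<in> X" "\<And>e N. e > 0 \<Longrightarrow> \<exists>n\<ge>N. d z (x n) < e"
    using cluster_point[of x] xy(1) by blast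
  obtain r where r: "r > 0"
    "\<And>n w. w \<in> X \<Longrightarrow> d z w < r \<Longrightarrow> d ((f ^^ n) z) ((f ^^ n) w) < e / 2"
    using equicontinuous z(1) e unfolding equicontinuous_system_def by (meson half_gt_zero)
  obtain N where N: "1 / real (Suc N) < r / 2" using nat_approx_posE[of "r / 2"] r(1) by auto
  obtain m where m: "m \<ge> N" "d z (x m) < r / 2" using z(2)[of "r / 2" N] r(1) by auto
  have "1 / real (Suc m) \<le> 1 / real (Suc N)" using m by (intro divide_left_mono) auto
  then have "d z (y m) < r"
    using triangle[OF z(1) xy(1) xy(2), of m m] xy(3)[of m] N m(2) by linarith
  then have "d ((f ^^ n m) z) ((f ^^ n m) (x m)) < e / 2" "d ((f ^^ n m) z) ((f ^^ n m) (y m)) < e / 2"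
    using r xy(1,2) m(2) by auto
  moreover have "d ((f ^^ n m) (x m)) ((f ^^ n m) (y m))
      \<le> d ((f ^^ n m) (x m)) ((f ^^ n m) z) + d ((f ^^ n m) z) ((f ^^ n m) (y m))"
    using xy z by (intro triangle) auto
  ultimately show False using xy(4)[of m] commute[of "(f ^^ n m) z" "(f ^^ n m) (x m)"] by linarith
qed

lemma uniform_hyperspace:
  assumes e: "e > 0"
  obtains r where "r > 0"
    "\<And>A B n. A \<in> H \<Longrightarrow> B \<in> H \<Longrightarrow> dH A B < r \<Longrightarrow> dH ((f ^^ n) ` A) ((f ^^ n) ` B) < e"
proof -
  obtain r where r: "r > 0"
    "\<And>x y n. x \<in> X \<Longrightarrow> y \<in> X \<Longrightarrow> d x y < r \<Longrightarrow> d ((f ^^ n) x) ((f ^^ n) y) < e / 2"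
    using uniform[of "e / 2"] e by auto
  have one: "\<exists>b\<in>(f ^^ n) ` B. d a b \<le> e / 2"
    if AB: "A \<in> H" "B \<in> H" "dH A B < r" and a: "a \<in> (f ^^ n) ` A" for A B n a
  proof -
    obtain a' where a': "a' \<in> A" "a = (f ^^ n) a'" using a by blast
    obtain b where b: "b \<in> B" "d a' b < r" using hausdorff_lessD[OF AB a'(1)] by blast
    have "d a ((f ^^ n) b) < e / 2" using r(2)[of a' b n] a' b AB H_sub by blast
    then show ?thesis using b(1) by force
  qed
  have "dH ((f ^^ n) ` A) ((f ^^ n) ` B) < e" if AB: "A \<in> H" "B \<in> H" "dH A B < r" for A B n
  proof -
    have BA: "dH B A < r" using AB(3) hyper.commute by metis
    have "dH ((f ^^ n) ` A) ((f ^^ n) ` B) \<le> e / 2"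
    proof (rule hausdorff_le)
      fix b assume "b \<in> (f ^^ n) ` B"
      from one[OF AB(2,1) BA this] show "\<exists>a\<in>(f ^^ n) ` A. d a b \<le> e / 2"
        using commute by metis
    qed (use one[OF AB] AB in auto)
    then show ?thesis using e by linarith
  qed
  then show ?thesis using that r(1) by blast
qed

lemma equicontinuous_hyperspace: "equicontinuous_system H dH (image f)"
  unfolding equicontinuous_system_def funpow_image
proof (intro ballI allI impI)
  fix A and e :: real assume A: "A \<in> H" and e: "e > 0"
  obtain r where "r > 0"
    "\<And>A B n. A \<in> H \<Longrightarrow> B \<in> H \<Longrightarrow> dH A B < r \<Longrightarrow> dH ((f ^^ n) ` A) ((f ^^ n) ` B) < e"
    by (rule uniform_hyperspace[OF e]) (rule that)
  with A show "\<exists>r>0. \<forall>n. \<forall>B\<in>H. dH A B < r \<longrightarrow> dH ((f ^^ n) ` A) ((f ^^ n) ` B) < e"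
    by (intro exI[of _ r]) simp
qed

text \<open>Sets that are once close enough stay close forever, so proximal pairs are
  asymptotic.\<close>

lemma no_Li_Yorke_pair:
  assumes "A \<in> H" "B \<in> H"
  shows "\<not> Li_Yorke_pair dH (image f) A B"
proof
  assume "Li_Yorke_pair dH (image f) A B"
  then have prox: "\<And>e N. e > 0 \<Longrightarrow> \<exists>n\<ge>N. dH ((f ^^ n) ` A) ((f ^^ n) ` B) < e"
    and "\<not> asymptotic dH (image f) A B"
    by (auto simp: Li_Yorke_pair_def proximal_iff)
  moreover have "(\<lambda>n. dH ((f ^^ n) ` A) ((f ^^ n) ` B)) \<longlonglongrightarrow> 0"
  proof (rule LIMSEQ_I)
    fix e :: real assume e: "e > 0"
    obtain r where r: "r > 0"
      "\<And>A B n. A \<in> H \<Longrightarrow> B \<in> H \<Longrightarrow> dH A B < r \<Longrightarrow> dH ((f ^^ n) ` A) ((f ^^ n) ` B) < e"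
      by (rule uniform_hyperspace[OF e]) (rule that)
    obtain m where m: "dH ((f ^^ m) ` A) ((f ^^ m) ` B) < r" using prox[OF r(1)] by blast
    have "dH ((f ^^ n) ` A) ((f ^^ n) ` B) < e" if "n \<ge> m" for n
      using r(2)[OF _ _ m, of "n - m"] assms that by (simp flip: pow_image_add)
    then show "\<exists>N. \<forall>n\<ge>N. norm (dH ((f ^^ n) ` A) ((f ^^ n) ` B) - 0) < e" by auto
  qed
  ultimately show False by (simp add: asymptotic_iff)
qed

text \<open>Both orbits pass close to \<open>E\<close>, at times \<open>i\<close> and
  \<open>j\<close>. By uniformity they remain close from then on, up to the shift between
  \<open>i\<close> and \<open>j\<close>, so the limits of one are limits of the other.\<close>

lemma omega_limit_subset:
  assumes A: "A \<in> H" and B: "B \<in> H" and "E \<in> omega_limit H dH (image f) A" "E \<in> omega_limit H dH (image f) B"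
  shows "omega_limit H dH (image f) A \<subseteq> omega_limit H dH (image f) B"
proof
  fix D assume "D \<in> omega_limit H dH (image f) A"
  then have D: "D \<in> H" "\<And>e N. e > 0 \<Longrightarrow> \<exists>k\<ge>N. dH ((f ^^ k) ` A) D < e"
    using omega_limit_iff[OF A] by auto
  have EA: "E \<in> H" "\<And>e N. e > 0 \<Longrightarrow> \<exists>k\<ge>N. dH ((f ^^ k) ` A) E < e"
    using assms(3) omega_limit_iff[OF A] by auto
  have EB: "\<And>e N. e > 0 \<Longrightarrow> \<exists>k\<ge>N. dH ((f ^^ k) ` B) E < e"
    using assms(4) omega_limit_iff[OF B] by auto
  have "\<exists>k\<ge>N. dH ((f ^^ k) ` B) D < e" if e: "e > 0" for e N
  proof -
    obtain r where r: "r > 0"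
      "\<And>A B n. A \<in> H \<Longrightarrow> B \<in> H \<Longrightarrow> dH A B < r \<Longrightarrow> dH ((f ^^ n) ` A) ((f ^^ n) ` B) < e / 2"
      using uniform_hyperspace[of "e / 2"] e by auto
    obtain i where i: "dH ((f ^^ i) ` A) E < r / 2" using EA(2)[of "r / 2"] r(1) by auto
    obtain j where j: "dH ((f ^^ j) ` B) E < r / 2" using EB[of "r / 2"] r(1) by auto
    have "dH ((f ^^ j) ` B) ((f ^^ i) ` A) \<le> dH ((f ^^ j) ` B) E + dH E ((f ^^ i) ` A)"
      using A B EA(1) by (intro hyper.triangle) auto
    then have ij: "dH ((f ^^ j) ` B) ((f ^^ i) ` A) < r"
      using i j hyper.commute[of E] by simp
    \<comment> \<open>\<open>N + i\<close> ensures that \<open>k - i\<close> is a true difference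
      and that \<open>k - i + j\<close> is at least \<open>N\<close>.\<close>
    obtain k where k: "k \<ge> N + i" "dH ((f ^^ k) ` A) D < e / 2" using D(2)[of "e / 2"] e by auto
    have "dH ((f ^^ (k - i)) ` (f ^^ j) ` B) ((f ^^ (k - i)) ` (f ^^ i) ` A) < e / 2"
      using r(2)[OF _ _ ij] A B by simp
    then have "dH ((f ^^ (k - i + j)) ` B) ((f ^^ k) ` A) < e / 2"
      using k(1) by (simp flip: pow_image_add)
    moreover have "dH ((f ^^ (k - i + j)) ` B) D
        \<le> dH ((f ^^ (k - i + j)) ` B) ((f ^^ k) ` A) + dH ((f ^^ k) ` A) D"
      using A B D(1) by (intro hyper.triangle) auto
    ultimately show ?thesis using k by (intro exI[of _ "k - i + j"]) auto
  qed
  then show "D \<in> omega_limit H dH (image f) B" using D(1) omega_limit_iff[OF B] by blast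
qed

text \<open>Each point follows a nearby net point, and net points return exactly at multiples of
  \<open>L\<close>.\<close>

lemma almost_fixing_period:
  assumes e: "e > 0"
  obtains L where "L \<ge> 1" "\<And>k x. x \<in> X \<Longrightarrow> d ((f ^^ (k * L)) x) x < e"
proof -
  obtain r where r: "r > 0"
    "\<And>x y n. x \<in> X \<Longrightarrow> y \<in> X \<Longrightarrow> d x y < r \<Longrightarrow> d ((f ^^ n) x) ((f ^^ n) y) < e / 2"
    using uniform[of "e / 2"] e by auto
  obtain N where N: "finite N" "N \<subseteq> X" "\<And>y. y \<in> X \<Longrightarrow> \<exists>z\<in>N. d z y < min r (e / 2)"
    using finite_net[of X "min r (e / 2)"] r(1) e by auto
  obtain L where L: "L \<ge> 1" "\<And>a. a \<in> N \<Longrightarrow> (f ^^ L) a = a"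
    using common_period[OF N(1,2)] by metis
  have "d ((f ^^ (k * L)) x) x < e" if x: "x \<in> X" for k x
  proof -
    obtain z where z: "z \<in> N" "d z x < r" "d z x < e / 2" using N(3)[OF x] by auto
    have zX: "z \<in> X" using z(1) N(2) by blast
    have "d ((f ^^ (k * L)) z) ((f ^^ (k * L)) x) < e / 2" using r(2)[OF zX x z(2)] .
    moreover have "(f ^^ (k * L)) z = z" using funpow_mult_fixed[OF L(2)[OF z(1)]] .
    moreover have "d ((f ^^ (k * L)) x) x \<le> d ((f ^^ (k * L)) x) z + d z x"
      using x zX by (intro triangle) auto
    ultimately show ?thesis using z(3) commute[of z] by simp
  qed
  then show ?thesis using that L(1) by blast
qed

lemma all_almost_periodic:
  assumes A: "A \<in> H"
  shows "A \<in> almost_periodic_points H dH (image f)"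
  unfolding almost_periodic_points_def
proof (intro CollectI conjI allI impI)
  fix U assume U: "openin hyper.mtopology U \<and> A \<in> U"
  then obtain e where e: "e > 0" "hyper.mball A e \<subseteq> U" unfolding hyper.openin_mtopology by blast
  obtain L where L: "L \<ge> 1" "\<And>k x. x \<in> X \<Longrightarrow> d ((f ^^ (k * L)) x) x < e / 2"
    using almost_fixing_period[of "e / 2"] e by auto
  have near: "dH ((f ^^ (k * L)) ` A) A \<le> e / 2" for k
  proof (rule hausdorff_le)
    have "d ((f ^^ (k * L)) x) x \<le> e / 2" if "x \<in> A" for x
      using L(2)[of x k] H_sub[OF A] that by auto
    then show "\<And>a. a \<in> (f ^^ (k * L)) ` A \<Longrightarrow> \<exists>b\<in>A. d a b \<le> e / 2"
      "\<And>b. b \<in> A \<Longrightarrow> \<exists>a\<in>(f ^^ (k * L)) ` A. d a b \<le> e / 2" by blast+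
  qed (use A in auto)
  show "\<exists>N. \<forall>n. {(image f ^^ (n + i)) A |i. i \<in> {0..N}} \<inter> U \<noteq> {}"
  proof (intro exI allI)
    fix n
    \<comment> \<open>Every window of length \<open>L\<close> contains a multiple of
      \<open>L\<close>, at which \<open>A\<close> is almost back in place.\<close>
    have "n + (L - n mod L) = (n div L + 1) * L" by (rule add_diff_mod_eq[OF L(1)])
    then have "(image f ^^ (n + (L - n mod L))) A \<in> hyper.mball A e"
      using near[of "n div L + 1"] A e(1) hyper.commute[of A] by (simp add: funpow_image)
    moreover have "L - n mod L \<in> {0..L}" by simp
    ultimately show "{(image f ^^ (n + i)) A |i. i \<in> {0..L}} \<inter> U \<noteq> {}" using e(2) by blast
  qed
qed (rule A)

text \<open>Limit sets that meet are contained in each other by \<open>omega_limit_subset\<close>,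
  so their difference is empty and not uncountable.\<close>

lemma no_omega_scrambled_pair:
  assumes "omega_scrambled_set H dH (image f) S" "A \<in> S" "B \<in> S" "A \<noteq> B"
  shows False
proof -
  have S: "S \<subseteq> H"
    "\<And>A B. A \<in> S \<Longrightarrow> B \<in> S \<Longrightarrow> A \<noteq> B \<Longrightarrow>
      uncountable (omega_limit H dH (image f) A - omega_limit H dH (image f) B) \<and>
      omega_limit H dH (image f) A \<inter> omega_limit H dH (image f) B \<noteq> {}"
    using assms(1) by (simp_all add: omega_scrambled_set_def)
  note AB = S(2)[OF assms(2-4)]
  obtain E where "E \<in> omega_limit H dH (image f) A" "E \<in> omega_limit H dH (image f) B"
    using AB by blast
  moreover have "A \<in> H" "B \<in> H" using S(1) assms(2,3) by auto
  ultimately have "omega_limit H dH (image f) A - omega_limit H dH (image f) B = {}"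
    using omega_limit_subset[of A B E] by simp
  then show False using AB by (metis countable_empty)
qed

end

subsection \<open>The equivalence\<close>

lemma uncountable_distinct:
  assumes "uncountable S"
  obtains a b where "a \<in> S" "b \<in> S" "a \<noteq> b"
proof -
  obtain a where a: "a \<in> S" using assms by (metis countable_empty ex_in_conv)
  have "uncountable (S - {a})" using assms by (simp add: uncountable_minus_countable)
  then have "S - {a} \<noteq> {}" by (metis countable_empty)
  then show ?thesis using that a by blast
qed

lemma all_equivalentI:
  assumes "\<And>P. P \<in> set Ps \<Longrightarrow> P \<longleftrightarrow> Q"
  shows "all_equivalent Ps"
  unfolding all_equivalent_def
proof (intro ballI)
  fix P R assume "P \<in> set Ps" "R \<in> set Ps"
  from assms[OF this(1)] assms[OF this(2)] show "P \<longleftrightarrow> R" by (rule trans[OF _ sym])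
qed

theorem theorem6p2:
  fixes X :: "'a set" and d :: "'a \<Rightarrow> 'a \<Rightarrow> real" and f :: "'a \<Rightarrow> 'a"
  assumes "Metric_space X d"
    and "compact_space (Metric_space.mtopology X d)"
    and "homeomorphic_map (Metric_space.mtopology X d) (Metric_space.mtopology X d) f"
    and "pointwise_periodic X f"
  shows
    "all_equivalent
       [\<not> equicontinuous_system X d f,
        \<not> equicontinuous_system (hyperspace X d) (hausdorff_dist X d) (image f),
        (\<exists>S. uncountable S \<and>
             S \<subseteq> recurrent_points (hyperspace X d) (hausdorff_dist X d) (image f) \<and>
             scrambled_set (hyperspace X d) (hausdorff_dist X d) (image f) S \<and>
             omega_scrambled_set (hyperspace X d) (hausdorff_dist X d) (image f) S),
        (\<exists>A\<in>hyperspace X d. \<exists>B\<in>hyperspace X d.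
             Li_Yorke_pair (hausdorff_dist X d) (image f) A B),
        (\<exists>S. omega_scrambled_set (hyperspace X d) (hausdorff_dist X d) (image f) S \<and>
             (\<exists>A\<in>S. \<exists>B\<in>S. A \<noteq> B)),
        recurrent_points (hyperspace X d) (hausdorff_dist X d) (image f) -
          almost_periodic_points (hyperspace X d) (hausdorff_dist X d) (image f) \<noteq> {}] \<and>
     ((\<exists>S. uncountable S \<and>
           S \<subseteq> recurrent_points (hyperspace X d) (hausdorff_dist X d) (image f) \<and>
           scrambled_set (hyperspace X d) (hausdorff_dist X d) (image f) S \<and>
           omega_scrambled_set (hyperspace X d) (hausdorff_dist X d) (image f) S) \<longrightarrow>
        Li_Yorke_chaotic (hyperspace X d) (hausdorff_dist X d) (image f) \<and>
        omega_chaotic (hyperspace X d) (hausdorff_dist X d) (image f))"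
proof -
  interpret Metric_space X d by fact
  obtain h where "homeomorphic_maps mtopology mtopology f h"
    using assms(3) homeomorphic_map_maps by blast
  then interpret periodic_homeo X d f h
    using assms by unfold_locales auto
  let ?equi = "equicontinuous_system X d f"
  let ?chaos = "\<exists>S. uncountable S \<and> S \<subseteq> recurrent_points H dH (image f) \<and>
    scrambled_set H dH (image f) S \<and> omega_scrambled_set H dH (image f) S"
  let ?pair = "\<exists>A\<in>H. \<exists>B\<in>H. Li_Yorke_pair dH (image f) A B"
  let ?omega = "\<exists>S. omega_scrambled_set H dH (image f) S \<and> (\<exists>A\<in>S. \<exists>B\<in>S. A \<noteq> B)"
  let ?nap = "recurrent_points H dH (image f) - almost_periodic_points H dH (image f) \<noteq> {}"
  have chaos: "?chaos" "?nap" if ne: "\<not> ?equi"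
  proof -
    obtain F where F: "uncountable F" "F \<subseteq> recurrent_points H dH (image f)"
      "F \<inter> almost_periodic_points H dH (image f) = {}"
      "scrambled_set H dH (image f) F" "omega_scrambled_set H dH (image f) F"
      by (rule not_equicontinuous_imp_chaotic_family[OF ne])
    then show ?chaos by blast
    have "F \<noteq> {}" using F(1) by (metis countable_empty)
    then show ?nap using F(2,3) by blast
  qed
  have pair: ?pair ?omega if c: ?chaos
  proof -
    obtain S where S: "uncountable S" "scrambled_set H dH (image f) S" "omega_scrambled_set H dH (image f) S"
      using c by blast
    obtain A B where AB: "A \<in> S" "B \<in> S" "A \<noteq> B" by (rule uncountable_distinct[OF S(1)])
    show ?omega using S(3) AB by blast
    show ?pair using S(2) AB unfolding scrambled_set_def by blast
  qed
  have tame: "equicontinuous_system H dH (image f)" "\<not> ?pair" "\<not> ?omega" "\<not> ?nap" if ?equi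
  proof -
    interpret equicontinuous_periodic_homeo X d f h
      using that by unfold_locales
    show "equicontinuous_system H dH (image f)" by (rule equicontinuous_hyperspace)
    show "\<not> ?pair" using no_Li_Yorke_pair by blast
    show "\<not> ?omega" using no_omega_scrambled_pair by blast
    show "\<not> ?nap" using all_almost_periodic unfolding recurrent_points_def by blast
  qed
  have "all_equivalent [\<not> ?equi, \<not> equicontinuous_system H dH (image f), ?chaos, ?pair, ?omega, ?nap]"
  \<comment> \<open>All statements are compared with the first. Without equicontinuity one has
    \<open>?chaos\<close> and \<open>?nap\<close>, and \<open>?chaos\<close> gives
    \<open>?pair\<close> and \<open>?omega\<close>. In the equicontinuous case \<open>tame\<close>
    refutes the others, \<open>?chaos\<close> by way of \<open>?pair\<close>.\<close>
  proof (rule all_equivalentI[where Q = "\<not> ?equi"])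
    fix P assume "P \<in> set [\<not> ?equi, \<not> equicontinuous_system H dH (image f), ?chaos, ?pair, ?omega, ?nap]"
    then consider "P = (\<not> ?equi)" | "P = (\<not> equicontinuous_system H dH (image f))" | "P = ?chaos"
      | "P = ?pair" | "P = ?omega" | "P = ?nap"
      by (simp only: list.set insert_iff empty_iff) blast
    then show "P \<longleftrightarrow> \<not> ?equi"
    proof cases
      case 2
      then show ?thesis using tame(1) equicontinuous_hyperspace_imp by metis
    next
      case 3
      then show ?thesis using chaos(1) pair(1) tame(2) by metis
    next
      case 4
      then show ?thesis using chaos(1) pair(1) tame(2) by metis
    next
      case 5
      then show ?thesis using chaos(1) pair(2) tame(3) by metis
    next
      case 6
      then show ?thesis using chaos(2) tame(4) by metis
    qed simp
  qed
  moreover have "?chaos \<longrightarrow> Li_Yorke_chaotic H dH (image f) \<and> omega_chaotic H dH (image f)"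
  proof
    assume ?chaos
    then obtain S where "uncountable S" "scrambled_set H dH (image f) S"
      "omega_scrambled_set H dH (image f) S" by blast
    then show "Li_Yorke_chaotic H dH (image f) \<and> omega_chaotic H dH (image f)"
      unfolding Li_Yorke_chaotic_def omega_chaotic_def by (intro conjI exI)
  qed
  ultimately show ?thesis by (rule conjI)
qed

end
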